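(* Let $(M,\varphi,\xi,\eta,g)$ be a regular $f$-Kenmotsu manifold with Levi-Civita connection $\nabla$ and Ricci tensor $S$, and let $V$ be a vector field on $M$. If the $(0,2)$-tensor field $\mathcal{L}_Vg+2S$ is parallel (with respect to $\nabla$), then $(g,V)$ yields a Ricci soliton, i.e. there is a real number $\lambda$ such that $\mathcal{L}_Vg+2S+2\lambda g=0$. In particular, the same conclusion holds if $(M,g)$ is Ricci-semisymmetric or semisymmetric and $\mathcal{L}_Vg$ is parallel.
   Context: All objects are $C^\infty$; manifolds are connected. An almost contact metric manifold is a $(2n+1)$-dimensional manifold $M$ ($n\ge 1$) with a $(1,1)$-tensor field $\varphi$, a vector field $\xi$, a 1-form $\eta$ and a Riemannian metric $g$ such that $\varphi^2=-I+\eta\otimes\xi$, $\eta(\xi)=1$, $\eta\circ\varphi=0$, $\varphi(\xi)=0$, $\eta(X)=g(X,\xi)$ and $g(\varphi X,\varphi Y)=g(X,Y)-\eta(X)\eta(Y)$ for all vector fields $X,Y$. It is an $f$-Kenmotsu manifold if its Levi-Civita connection $\nabla$ satisfies $(\nabla_X\varphi)(Y)=f\,(g(\varphi X,Y)\xi-\varphi(X)\eta(Y))$ for all $X,Y$, where $f\in C^\infty(M)$ is strictly positive and $df\wedge\eta=0$. An $f$-Kenmotsu manifold is regular if $f^2+\xi(f)\neq 0$ at every point of $M$. $\mathcal{L}_V$ denotes the Lie derivative along $V$. Let $R$ be the curvature tensor of $g$. The manifold is Ricci-semisymmetric if $R\cdot S=0$, where $(R(X,Y)\cdot S)(X_1,X_2)=-S(R(X,Y)X_1,X_2)-S(X_1,R(X,Y)X_2)$.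 It is semisymmetric if $R\cdot R=0$, where $R(X,Y)$ acts as a derivation on the tensor field $R$. *)

theory Defs
  imports "HOL-Analysis.Analysis"
begin

section \<open>Smooth maps between Euclidean spaces\<close>

text \<open>Only used for open \<open>U\<close>: all iterated directional derivatives exist and are themselves
  differentiable.\<close>

primrec Ck_on :: "nat \<Rightarrow> 'e::euclidean_space set \<Rightarrow> ('e \<Rightarrow> 'b::real_normed_vector) \<Rightarrow> bool" where
  "Ck_on 0 U h \<longleftrightarrow> continuous_on U h"
| "Ck_on (Suc k) U h \<longleftrightarrow>
     (\<forall>x\<in>U. h differentiable (at x)) \<and> (\<forall>v. Ck_on k U (\<lambda>x. frechet_derivative h (at x) v))"

definition smooth_on :: "'e::euclidean_space set \<Rightarrow> ('e \<Rightarrow> 'b::real_normed_vector) \<Rightarrow> bool" where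
  "smooth_on U h \<longleftrightarrow> (\<forall>k. Ck_on k U h)"


section \<open>Smooth manifolds\<close>

text \<open>The underlying space of the manifold is a whole topological type \<open>'a\<close>, and the model space
  is \<open>'e\<close>, so the dimension is \<open>DIM('e)\<close>. A chart is its domain paired with its coordinate map;
  values of the coordinate map outside the domain are irrelevant.\<close>

type_synonym ('a, 'e) chart = "'a set \<times> ('a \<Rightarrow> 'e)"

definition chart_inv :: "('a, 'e) chart \<Rightarrow> 'e \<Rightarrow> 'a" where
  "chart_inv c = inv_into (fst c) (snd c)"

definition smooth_atlas :: "('a::topological_space, 'e::euclidean_space) chart set \<Rightarrow> bool" where
  "smooth_atlas A \<longleftrightarrow>
     (\<Union>c\<in>A. fst c) = UNIV \<and>
     (\<forall>c\<in>A. open (fst c) \<and> open (snd c ` fst c) \<and>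
        homeomorphism (fst c) (snd c ` fst c) (snd c) (chart_inv c)) \<and>
     (\<forall>c\<in>A. \<forall>d\<in>A. smooth_on (snd c ` (fst c \<inter> fst d)) (snd d \<circ> chart_inv c))"

definition smooth_fun :: "('a, 'e::euclidean_space) chart set \<Rightarrow> ('a \<Rightarrow> real) \<Rightarrow> bool" where
  "smooth_fun A h \<longleftrightarrow> (\<forall>c\<in>A. smooth_on (snd c ` fst c) (h \<circ> chart_inv c))"

text \<open>Each tangent space \<open>T\<^sub>p M\<close> is identified with \<open>'e\<close> through one fixed chart \<open>chart_at A p\<close>
  around \<open>p\<close>: the vector \<open>v :: 'e\<close> at \<open>p\<close> is the tangent vector whose components in that chart
  are \<open>v\<close>. Since the chart varies with \<open>p\<close> in an arbitrary way, smoothness of a field has to be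
  tested on its components in the charts of the atlas, which \<open>components\<close> computes with the
  Jacobian of the change of charts.\<close>

definition chart_at :: "('a, 'e) chart set \<Rightarrow> 'a \<Rightarrow> ('a, 'e) chart" where
  "chart_at A p = (SOME c. c \<in> A \<and> p \<in> fst c)"

definition components ::
    "('a, 'e::euclidean_space) chart set \<Rightarrow> ('a, 'e) chart \<Rightarrow> 'a \<Rightarrow> 'e \<Rightarrow> 'e" where
  "components A c p v =
     frechet_derivative (snd c \<circ> chart_inv (chart_at A p)) (at (snd (chart_at A p) p)) v"

definition differential ::
    "('a, 'e::euclidean_space) chart set \<Rightarrow> ('a \<Rightarrow> real) \<Rightarrow> 'a \<Rightarrow> 'e \<Rightarrow> real" where
  "differential A h p v =
     frechet_derivative (h \<circ> chart_inv (chart_at A p)) (at (snd (chart_at A p) p)) v"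

text \<open>Smooth vector fields, and their action \<open>X(h)\<close> on functions.\<close>

definition vector_field :: "('a, 'e::euclidean_space) chart set \<Rightarrow> ('a \<Rightarrow> 'e) \<Rightarrow> bool" where
  "vector_field A X \<longleftrightarrow>
     (\<forall>c\<in>A. smooth_on (snd c ` fst c) (\<lambda>x. components A c (chart_inv c x) (X (chart_inv c x))))"

definition vf_deriv ::
    "('a, 'e::euclidean_space) chart set \<Rightarrow> ('a \<Rightarrow> 'e) \<Rightarrow> ('a \<Rightarrow> real) \<Rightarrow> 'a \<Rightarrow> real" where
  "vf_deriv A X h = (\<lambda>p. differential A h p (X p))"

definition lie_bracket ::
    "('a, 'e::euclidean_space) chart set \<Rightarrow> ('a \<Rightarrow> 'e) \<Rightarrow> ('a \<Rightarrow> 'e) \<Rightarrow> 'a \<Rightarrow> 'e" where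
  "lie_bracket A X Y p =
     (THE v. \<forall>h. smooth_fun A h \<longrightarrow>
        differential A h p v = vf_deriv A X (vf_deriv A Y h) p - vf_deriv A Y (vf_deriv A X h) p)"


section \<open>Tensor fields\<close>

text \<open>Given tensor fields are families of linear maps on the tangent spaces that send smooth vector
  fields to smooth objects.\<close>

definition one_form :: "('a, 'e::euclidean_space) chart set \<Rightarrow> ('a \<Rightarrow> 'e \<Rightarrow> real) \<Rightarrow> bool" where
  "one_form A \<eta> \<longleftrightarrow>
     (\<forall>p. linear (\<eta> p)) \<and> (\<forall>X. vector_field A X \<longrightarrow> smooth_fun A (\<lambda>p. \<eta> p (X p)))"

definition tensor_field_1_1 :: "('a, 'e::euclidean_space) chart set \<Rightarrow> ('a \<Rightarrow> 'e \<Rightarrow> 'e) \<Rightarrow> bool" where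
  "tensor_field_1_1 A \<phi> \<longleftrightarrow>
     (\<forall>p. linear (\<phi> p)) \<and> (\<forall>X. vector_field A X \<longrightarrow> vector_field A (\<lambda>p. \<phi> p (X p)))"

definition riemannian_metric ::
    "('a, 'e::euclidean_space) chart set \<Rightarrow> ('a \<Rightarrow> 'e \<Rightarrow> 'e \<Rightarrow> real) \<Rightarrow> bool" where
  "riemannian_metric A g \<longleftrightarrow>
     (\<forall>p. bilinear (g p) \<and> (\<forall>u v. g p u v = g p v u) \<and> (\<forall>v. v \<noteq> 0 \<longrightarrow> 0 < g p v v)) \<and>
     (\<forall>X Y. vector_field A X \<longrightarrow> vector_field A Y \<longrightarrow> smooth_fun A (\<lambda>p. g p (X p) (Y p)))"

text \<open>Derived \<open>(0,2)\<close>-tensor fields (Lie derivatives, the Ricci tensor) are represented by their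
  action on vector fields. The operations on them below are meant for smooth vector field
  arguments only.\<close>

type_synonym ('a, 'e) tensor02 = "('a \<Rightarrow> 'e) \<Rightarrow> ('a \<Rightarrow> 'e) \<Rightarrow> 'a \<Rightarrow> real"

definition as_tensor02 :: "('a \<Rightarrow> 'e \<Rightarrow> 'e \<Rightarrow> real) \<Rightarrow> ('a, 'e) tensor02" where
  "as_tensor02 g X Y = (\<lambda>p. g p (X p) (Y p))"

definition lie_derivative :: "('a, 'e::euclidean_space) chart set \<Rightarrow> ('a \<Rightarrow> 'e) \<Rightarrow>
    ('a, 'e) tensor02 \<Rightarrow> ('a, 'e) tensor02" where
  "lie_derivative A V T X Y = (\<lambda>p.
     vf_deriv A V (T X Y) p - T (lie_bracket A V X) Y p - T X (lie_bracket A V Y) p)"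


section \<open>Connections and curvature\<close>

type_synonym ('a, 'e) connection = "('a \<Rightarrow> 'e) \<Rightarrow> ('a \<Rightarrow> 'e) \<Rightarrow> 'a \<Rightarrow> 'e"

definition affine_connection ::
    "('a, 'e::euclidean_space) chart set \<Rightarrow> ('a, 'e) connection \<Rightarrow> bool" where
  "affine_connection A nabla \<longleftrightarrow>
     (\<forall>X Y. vector_field A X \<longrightarrow> vector_field A Y \<longrightarrow> vector_field A (nabla X Y)) \<and>
     (\<forall>X X' Y. vector_field A X \<longrightarrow> vector_field A X' \<longrightarrow> vector_field A Y \<longrightarrow>
        nabla (\<lambda>p. X p + X' p) Y = (\<lambda>p. nabla X Y p + nabla X' Y p)) \<and>
     (\<forall>h X Y. smooth_fun A h \<longrightarrow> vector_field A X \<longrightarrow> vector_field A Y \<longrightarrow>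
        nabla (\<lambda>p. h p *\<^sub>R X p) Y = (\<lambda>p. h p *\<^sub>R nabla X Y p)) \<and>
     (\<forall>X Y Y'. vector_field A X \<longrightarrow> vector_field A Y \<longrightarrow> vector_field A Y' \<longrightarrow>
        nabla X (\<lambda>p. Y p + Y' p) = (\<lambda>p. nabla X Y p + nabla X Y' p)) \<and>
     (\<forall>h X Y. smooth_fun A h \<longrightarrow> vector_field A X \<longrightarrow> vector_field A Y \<longrightarrow>
        nabla X (\<lambda>p. h p *\<^sub>R Y p) = (\<lambda>p. vf_deriv A X h p *\<^sub>R Y p + h p *\<^sub>R nabla X Y p))"

definition parallel ::
    "('a, 'e::euclidean_space) chart set \<Rightarrow> ('a, 'e) connection \<Rightarrow> ('a, 'e) tensor02 \<Rightarrow> bool" where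
  "parallel A nabla T \<longleftrightarrow>
     (\<forall>X Y Z. vector_field A X \<longrightarrow> vector_field A Y \<longrightarrow> vector_field A Z \<longrightarrow>
        (\<forall>p. vf_deriv A X (T Y Z) p - T (nabla X Y) Z p - T Y (nabla X Z) p = 0))"

definition levi_civita :: "('a, 'e::euclidean_space) chart set \<Rightarrow>
    ('a \<Rightarrow> 'e \<Rightarrow> 'e \<Rightarrow> real) \<Rightarrow> ('a, 'e) connection \<Rightarrow> bool" where
  "levi_civita A g nabla \<longleftrightarrow>
     affine_connection A nabla \<and>
     (\<forall>X Y. vector_field A X \<longrightarrow> vector_field A Y \<longrightarrow>
        (\<forall>p. nabla X Y p - nabla Y X p = lie_bracket A X Y p)) \<and>
     parallel A nabla (as_tensor02 g)"

definition curvature :: "('a, 'e::euclidean_space) chart set \<Rightarrow> ('a, 'e) connection \<Rightarrow>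
    ('a \<Rightarrow> 'e) \<Rightarrow> ('a \<Rightarrow> 'e) \<Rightarrow> ('a \<Rightarrow> 'e) \<Rightarrow> 'a \<Rightarrow> 'e" where
  "curvature A nabla X Y Z = (\<lambda>p.
     nabla X (nabla Y Z) p - nabla Y (nabla X Z) p - nabla (lie_bracket A X Y) Z p)"

text \<open>The Ricci tensor \<open>S(Y,Z)\<close> at \<open>p\<close> is the trace of \<open>v \<mapsto> R(v,Y)Z\<close> on \<open>T\<^sub>p M\<close>, where \<open>R(v,Y)Z\<close> is
  computed with any smooth vector field extending \<open>v\<close>. The inner product of \<open>'e\<close> only serves
  to read off matrix coefficients; the trace does not depend on it.\<close>

definition extend_vector :: "('a, 'e::euclidean_space) chart set \<Rightarrow> 'a \<Rightarrow> 'e \<Rightarrow> 'a \<Rightarrow> 'e" where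
  "extend_vector A p v = (SOME X. vector_field A X \<and> X p = v)"

definition ricci ::
    "('a, 'e::euclidean_space) chart set \<Rightarrow> ('a, 'e) connection \<Rightarrow> ('a, 'e) tensor02" where
  "ricci A nabla Y Z = (\<lambda>p.
     \<Sum>b\<in>Basis. curvature A nabla (extend_vector A p b) Y Z p \<bullet> b)"

definition ricci_semisymmetric ::
    "('a, 'e::euclidean_space) chart set \<Rightarrow> ('a, 'e) connection \<Rightarrow> bool" where
  "ricci_semisymmetric A nabla \<longleftrightarrow>
     (\<forall>X Y X1 X2. vector_field A X \<longrightarrow> vector_field A Y \<longrightarrow> vector_field A X1 \<longrightarrow> vector_field A X2 \<longrightarrow>
        (\<forall>p. - ricci A nabla (curvature A nabla X Y X1) X2 p
             - ricci A nabla X1 (curvature A nabla X Y X2) p = 0))"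

definition semisymmetric ::
    "('a, 'e::euclidean_space) chart set \<Rightarrow> ('a, 'e) connection \<Rightarrow> bool" where
  "semisymmetric A nabla \<longleftrightarrow> (let R = curvature A nabla in
     \<forall>X Y X1 X2 X3. vector_field A X \<longrightarrow> vector_field A Y \<longrightarrow>
        vector_field A X1 \<longrightarrow> vector_field A X2 \<longrightarrow> vector_field A X3 \<longrightarrow>
        (\<forall>p. R X Y (R X1 X2 X3) p - R (R X Y X1) X2 X3 p
             - R X1 (R X Y X2) X3 p - R X1 X2 (R X Y X3) p = 0))"

definition ricci_soliton :: "('a, 'e::euclidean_space) chart set \<Rightarrow> ('a, 'e) connection \<Rightarrow>
    ('a \<Rightarrow> 'e \<Rightarrow> 'e \<Rightarrow> real) \<Rightarrow> ('a \<Rightarrow> 'e) \<Rightarrow> real \<Rightarrow> bool" where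
  "ricci_soliton A nabla g V l \<longleftrightarrow>
     (\<forall>X Y. vector_field A X \<longrightarrow> vector_field A Y \<longrightarrow>
        (\<forall>p. lie_derivative A V (as_tensor02 g) X Y p + 2 * ricci A nabla X Y p
             + 2 * l * as_tensor02 g X Y p = 0))"


section \<open>Almost contact metric and \<open>f\<close>-Kenmotsu structures\<close>

definition almost_contact_metric :: "('a, 'e::euclidean_space) chart set \<Rightarrow> ('a \<Rightarrow> 'e \<Rightarrow> 'e) \<Rightarrow>
    ('a \<Rightarrow> 'e) \<Rightarrow> ('a \<Rightarrow> 'e \<Rightarrow> real) \<Rightarrow> ('a \<Rightarrow> 'e \<Rightarrow> 'e \<Rightarrow> real) \<Rightarrow> bool" where
  "almost_contact_metric A \<phi> \<xi> \<eta> g \<longleftrightarrow>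
     tensor_field_1_1 A \<phi> \<and> vector_field A \<xi> \<and> one_form A \<eta> \<and> riemannian_metric A g \<and>
     (\<forall>p v. \<phi> p (\<phi> p v) = - v + \<eta> p v *\<^sub>R \<xi> p) \<and>
     (\<forall>p. \<eta> p (\<xi> p) = 1) \<and>
     (\<forall>p v. \<eta> p (\<phi> p v) = 0) \<and>
     (\<forall>p. \<phi> p (\<xi> p) = 0) \<and>
     (\<forall>p v. \<eta> p v = g p v (\<xi> p)) \<and>
     (\<forall>p u v. g p (\<phi> p u) (\<phi> p v) = g p u v - \<eta> p u * \<eta> p v)"

definition f_kenmotsu :: "('a, 'e::euclidean_space) chart set \<Rightarrow> ('a \<Rightarrow> 'e \<Rightarrow> 'e) \<Rightarrow>
    ('a \<Rightarrow> 'e) \<Rightarrow> ('a \<Rightarrow> 'e \<Rightarrow> real) \<Rightarrow> ('a \<Rightarrow> 'e \<Rightarrow> 'e \<Rightarrow> real) \<Rightarrow> ('a, 'e) connection \<Rightarrow>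
    ('a \<Rightarrow> real) \<Rightarrow> bool" where
  "f_kenmotsu A \<phi> \<xi> \<eta> g nabla f \<longleftrightarrow>
     almost_contact_metric A \<phi> \<xi> \<eta> g \<and> levi_civita A g nabla \<and>
     smooth_fun A f \<and> (\<forall>p. 0 < f p) \<and>
     (\<forall>p u v. differential A f p u * \<eta> p v - differential A f p v * \<eta> p u = 0) \<and>
     (\<forall>X Y. vector_field A X \<longrightarrow> vector_field A Y \<longrightarrow>
        (\<forall>p. nabla X (\<lambda>q. \<phi> q (Y q)) p - \<phi> p (nabla X Y p) =
             f p *\<^sub>R (g p (\<phi> p (X p)) (Y p) *\<^sub>R \<xi> p - \<eta> p (Y p) *\<^sub>R \<phi> p (X p))))"

definition regular_f_kenmotsu :: "('a, 'e::euclidean_space) chart set \<Rightarrow> ('a \<Rightarrow> 'e \<Rightarrow> 'e) \<Rightarrow>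
    ('a \<Rightarrow> 'e) \<Rightarrow> ('a \<Rightarrow> 'e \<Rightarrow> real) \<Rightarrow> ('a \<Rightarrow> 'e \<Rightarrow> 'e \<Rightarrow> real) \<Rightarrow> ('a, 'e) connection \<Rightarrow>
    ('a \<Rightarrow> real) \<Rightarrow> bool" where
  "regular_f_kenmotsu A \<phi> \<xi> \<eta> g nabla f \<longleftrightarrow>
     f_kenmotsu A \<phi> \<xi> \<eta> g nabla f \<and> (\<forall>p. (f p)\<^sup>2 + vf_deriv A \<xi> f p \<noteq> 0)"

end

theory Submission
  imports Defs
begin

text \<open>On an \<open>f\<close>-Kenmotsu manifold \<open>\<nabla>\<^sub>X \<xi> = f (X - \<eta>(X) \<xi>)\<close>, hence
  \<open>R(X, \<xi>)Z = \<kappa> (g(X, Z) \<xi> - \<eta>(Z) X)\<close> with \<open>\<kappa> = f\<^sup>2 + \<xi>(f)\<close>, which regularity makes nowhere zero.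
  A tensor \<open>T\<close> with \<open>R \<cdot> T = 0\<close> is then \<open>T(\<xi>, \<xi>) g\<close>, and if \<open>T\<close> is parallel the factor is constant
  because \<open>\<nabla>\<^sub>X \<xi> \<bottom> \<xi>\<close>. This settles \<open>T = \<L>\<^sub>V g + 2 S\<close>. In the (Ricci-)semisymmetric case it
  applies to \<open>\<L>\<^sub>V g\<close> and shows that \<open>S = - 2 n \<kappa> g\<close>; the constancy of \<open>\<kappa>\<close> is a Schur type lemma from
  the second Bianchi identity.\<close>

section \<open>Calculus of smooth functions on open sets\<close>

text \<open>R . T = 0 follows from parallelism by applying the commutator of two derivations to the
  function T(Z, W). The formula for R(X, \<xi>)Z is the formula for R(X, Y)\<xi> read through the
  pair symmetry of the Riemann tensor.

  The two assertions differ in one point. A parallel tensor comes with a constant factor, whereas R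
  . S = 0 is an algebraic condition at each point and gives S = h g with a mere function h; a
  soliton needs h constant. This forces the second Bianchi identity, and with it the differentiation
  of a trace.

  The obstacle is locality. A tangent vector at p is stored in a chart chosen arbitrarily for p,
  while connection and curvature act on globally defined fields, so a local frame is not an
  admissible argument. Local computations therefore use a coordinate frame multiplied by a bump
  function: an identity acquires a factor \<rho>, which equals 1 at the point in question. In this
  way \<open>C^\<infinity>\<close>-linear operators are seen to act pointwise, and traces to be
  smooth and to commute with covariant differentiation.\<close>

lemma Ck_on_cong:
  assumes "open U" "\<And>x. x \<in> U \<Longrightarrow> f x = g x" "Ck_on k U f"
  shows "Ck_on k U g"
  using assms(2,3)
proof (induction k arbitrary: f g)
  case 0
  then show ?case by (simp cong: continuous_on_cong)
next
  case (Suc k)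
  have d: "(g has_derivative frechet_derivative f (at x)) (at x)" if "x \<in> U" for x
    using Suc.prems that assms(1)
    by (auto intro: has_derivative_transform_within_open simp: frechet_derivative_works)
  have "frechet_derivative f (at x) = frechet_derivative g (at x)" if "x \<in> U" for x
    using frechet_derivative_at[OF d[OF that]] .
  then have "Ck_on k U (\<lambda>x. frechet_derivative g (at x) v)" for v
    using Suc.IH[of "\<lambda>x. frechet_derivative f (at x) v"] Suc.prems by auto
  then show ?case using d by (auto simp: differentiable_def)
qed

lemma Ck_on_subset: "Ck_on k U f \<Longrightarrow> W \<subseteq> U \<Longrightarrow> Ck_on k W f"
  by (induction k arbitrary: f) (auto intro: continuous_on_subset)

lemma Ck_on_SucD: "Ck_on (Suc k) U f \<Longrightarrow> Ck_on k U f"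
proof (induction k arbitrary: f)
  case 0
  then show ?case
    by (auto intro!: continuous_at_imp_continuous_on differentiable_imp_continuous_within)
next
  case (Suc k)
  have "Ck_on k U (\<lambda>x. frechet_derivative f (at x) v)" for v
    using Suc by auto
  then show ?case using Suc.prems by auto
qed

text \<open>On an open set an explicitly exhibited derivative agrees with
  \<open>frechet_derivative\<close>, in terms of which \<open>Ck_on\<close> is stated. Most
  inductions below enter the successor case through this rule.\<close>

lemma Ck_on_SucI:
  assumes "open U" "\<And>x. x \<in> U \<Longrightarrow> (f has_derivative f' x) (at x)"
    "\<And>v. Ck_on k U (\<lambda>x. f' x v)"
  shows "Ck_on (Suc k) U f"
proof -
  have "f' x = frechet_derivative f (at x)" if "x \<in> U" for x
    using assms(2)[OF that] by (rule frechet_derivative_at)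
  then have "Ck_on k U (\<lambda>x. frechet_derivative f (at x) v)" for v
    using Ck_on_cong[OF assms(1) _ assms(3)[of v]] by auto
  then show ?thesis using assms(2) by (auto simp: differentiable_def)
qed

lemma Ck_on_const: "open U \<Longrightarrow> Ck_on k U (\<lambda>x. c)"
  by (induction k arbitrary: c) (auto intro: continuous_on_const)

lemma Ck_on_bounded_linear:
  assumes "open U" "bounded_linear f"
  shows "Ck_on k U f"
proof (cases k)
  case 0
  then show ?thesis using assms by (simp add: linear_continuous_on)
next
  case (Suc j)
  show ?thesis unfolding Suc
    by (rule Ck_on_SucI[where f' = "\<lambda>x. f"])
      (auto simp: assms bounded_linear_imp_has_derivative Ck_on_const)
qed

lemma Ck_on_add:
  assumes "open U" "Ck_on k U f" "Ck_on k U g"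
  shows "Ck_on k U (\<lambda>x. f x + g x)"
  using assms(2,3)
proof (induction k arbitrary: f g)
  case 0
  then show ?case by (simp add: continuous_on_add)
next
  case (Suc k)
  show ?case
    by (rule Ck_on_SucI[OF assms(1),
          where f' = "\<lambda>x v. frechet_derivative f (at x) v + frechet_derivative g (at x) v"])
      (use Suc in \<open>auto intro!: has_derivative_add simp: frechet_derivative_works[symmetric]\<close>)
qed

text \<open>The product rule writes the derivative as a sum of two values of \<open>b\<close>, to
  which the induction hypothesis applies. A general \<open>b\<close> covers scaling, multiplication
  and inner products at once.\<close>

lemma Ck_on_bilinear:
  assumes "open U" "bounded_bilinear b" "Ck_on k U f" "Ck_on k U g"
  shows "Ck_on k U (\<lambda>x. b (f x) (g x))"
  using assms(3,4)
proof (induction k arbitrary: f g)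
  case 0
  then show ?case using bounded_bilinear.continuous_on[OF assms(2)] by auto
next
  case (Suc k)
  have fg: "Ck_on k U f" "Ck_on k U g" using Suc.prems by (blast intro: Ck_on_SucD)+
  show ?case
    by (rule Ck_on_SucI[OF assms(1), where f' = "\<lambda>x v. b (f x) (frechet_derivative g (at x) v) +
          b (frechet_derivative f (at x) v) (g x)"])
      (use Suc fg in \<open>auto intro!: bounded_bilinear.FDERIV[OF assms(2)] Ck_on_add assms(1)
        simp: frechet_derivative_works[symmetric]\<close>)
qed

lemma Ck_on_sum:
  assumes "open U" "finite I" "\<And>i. i \<in> I \<Longrightarrow> Ck_on k U (f i)"
  shows "Ck_on k U (\<lambda>x. \<Sum>i\<in>I. f i x)"
  using assms(2,3)
  by (induction I rule: finite_induct) (auto intro: Ck_on_add Ck_on_const assms(1))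

text \<open>\<open>Ck_on\<close> controls derivatives in fixed directions only; this expansion
  reduces a varying direction to fixed ones.\<close>

lemma linear_eq_sum_Basis:
  fixes L :: "'e::euclidean_space \<Rightarrow> 'b::real_vector"
  assumes "linear L"
  shows "L w = (\<Sum>b\<in>Basis. (w \<bullet> b) *\<^sub>R L b)"
proof -
  have "L w = L (\<Sum>b\<in>Basis. (w \<bullet> b) *\<^sub>R b)"
    by (simp add: euclidean_representation)
  then show ?thesis
    by (simp add: linear_sum[OF assms] linear_cmul[OF assms])
qed

text \<open>The chain rule yields \<open>g' (f x) (f' x v)\<close>, whose direction moves with
  \<open>x\<close>. Expanded in the basis it is a sum of products in which each \<open>g'\<close>
  has a fixed direction, so the induction hypothesis applies to it.\<close>

lemma Ck_on_compose:
  fixes f :: "'e::euclidean_space \<Rightarrow> 'd::euclidean_space" and g :: "'d \<Rightarrow> 'b::real_normed_vector"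
  assumes "open U" "open W" "f ` U \<subseteq> W" "Ck_on k U f" "Ck_on k W g"
  shows "Ck_on k U (\<lambda>x. g (f x))"
  using assms(4,5)
proof (induction k arbitrary: g)
  case 0
  then show ?case using assms(3) by (auto intro: continuous_on_compose2)
next
  case (Suc k)
  have fk: "Ck_on k U f" using Suc.prems by (blast intro: Ck_on_SucD)
  define f' where "f' x = frechet_derivative f (at x)" for x
  define g' where "g' x = frechet_derivative g (at x)" for x
  have df: "(f has_derivative f' x) (at x)" if "x \<in> U" for x
    using Suc.prems that by (auto simp: f'_def frechet_derivative_works[symmetric])
  have dg: "(g has_derivative g' y) (at y)" if "y \<in> W" for y
    using Suc.prems that by (auto simp: g'_def frechet_derivative_works[symmetric])
  have ck: "Ck_on k U (\<lambda>x. (f' x v \<bullet> b) *\<^sub>R g' (f x) b)" for v b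
  proof (rule Ck_on_bilinear[OF assms(1) bounded_bilinear_scaleR])
    have "Ck_on k U (\<lambda>x. f' x v)" using Suc.prems by (auto simp: f'_def)
    from Ck_on_bilinear[OF assms(1) bounded_bilinear_inner this Ck_on_const[OF assms(1)]]
    show "Ck_on k U (\<lambda>x. f' x v \<bullet> b)" .
    have "Ck_on k W (\<lambda>y. g' y b)" using Suc.prems by (auto simp: g'_def)
    then show "Ck_on k U (\<lambda>x. g' (f x) b)" using Suc.IH fk by blast
  qed
  show ?case
  proof (rule Ck_on_SucI[OF assms(1), where f' = "\<lambda>x v. \<Sum>b\<in>Basis. (f' x v \<bullet> b) *\<^sub>R g' (f x) b"])
    fix x assume x: "x \<in> U"
    then have fx: "f x \<in> W" using assms(3) by auto
    have "((\<lambda>x. g (f x)) has_derivative (\<lambda>v. g' (f x) (f' x v))) (at x)"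
      using diff_chain_at[OF df[OF x] dg[OF fx]] by (simp add: o_def)
    then show "((\<lambda>x. g (f x)) has_derivative
        (\<lambda>v. \<Sum>b\<in>Basis. (f' x v \<bullet> b) *\<^sub>R g' (f x) b)) (at x)"
      by (rule has_derivative_eq_rhs)
        (rule ext, rule linear_eq_sum_Basis[OF has_derivative_linear[OF dg[OF fx]]])
  qed (use ck assms(1) in \<open>auto intro: Ck_on_sum\<close>)
qed

text \<open>The derivative - f' / f^2 is built from 1 / f and f' alone, so the induction
  closes.\<close>

lemma Ck_on_inverse:
  fixes f :: "'e::euclidean_space \<Rightarrow> real"
  assumes "open U" "Ck_on k U f" "\<And>x. x \<in> U \<Longrightarrow> f x \<noteq> 0"
  shows "Ck_on k U (\<lambda>x. inverse (f x))"
  using assms(2)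
proof (induction k)
  case 0
  then show ?case using assms(3) by (auto intro: continuous_on_inverse)
next
  case (Suc k)
  have fk: "Ck_on k U f" using Suc.prems by (blast intro: Ck_on_SucD)
  have mult: "Ck_on k U (\<lambda>x. a x * b x)" if "Ck_on k U a" "Ck_on k U b" for a b :: "'e \<Rightarrow> real"
    using Ck_on_bilinear[OF assms(1) bounded_bilinear_mult that] .
  define f' where "f' x = frechet_derivative f (at x)" for x
  have df: "(f has_derivative f' x) (at x)" if "x \<in> U" for x
    using Suc.prems that by (auto simp: f'_def frechet_derivative_works[symmetric])
  show ?case
  proof (rule Ck_on_SucI[OF assms(1),
        where f' = "\<lambda>x v. (- 1) * (inverse (f x) * f' x v * inverse (f x))"])
    fix x assume x: "x \<in> U"
    show "((\<lambda>x. inverse (f x)) has_derivative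
        (\<lambda>v. (- 1) * (inverse (f x) * f' x v * inverse (f x)))) (at x)"
      using Deriv.has_derivative_inverse[OF assms(3)[OF x] df[OF x]] by simp
  next
    fix v
    have "Ck_on k U (\<lambda>x. f' x v)" using Suc.prems by (auto simp: f'_def)
    then show "Ck_on k U (\<lambda>x. (- 1) * (inverse (f x) * f' x v * inverse (f x)))"
      using Suc.IH fk by (intro mult Ck_on_const assms(1)) auto
  qed
qed

section \<open>A smooth function on the line that is flat at the origin\<close>

text \<open>The functions \<open>x\<^sup>-\<^sup>n exp (- 1 / x)\<close>, extended by zero to \<open>x \<le> 0\<close>, are closed under
  differentiation up to linear combinations, so one induction shows that they are all smooth.\<close>

definition flat_exp :: "nat \<Rightarrow> real \<Rightarrow> real" where
  "flat_exp n x = (if x \<le> 0 then 0 else inverse x ^ n * exp (- inverse x))"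

lemma flat_exp_tendsto_0: "((\<lambda>x. flat_exp n x) \<longlongrightarrow> 0) (at 0)"
proof -
  \<comment> \<open>Under y = 1 / x the right-hand limit at 0 becomes this limit at
    infinity.\<close>
  have "((\<lambda>y::real. y ^ n / exp y) \<longlongrightarrow> 0) at_top"
    by (rule tendsto_power_div_exp_0)
  then have "((\<lambda>x::real. inverse x ^ n / exp (inverse x)) \<longlongrightarrow> 0) (at_right 0)"
    using filterlim_compose filterlim_inverse_at_top_right by blast
  moreover have "eventually (\<lambda>x. inverse x ^ n / exp (inverse x) = flat_exp n x) (at_right 0)"
    by (auto simp: eventually_at_filter flat_exp_def exp_minus field_simps)
  ultimately have "(flat_exp n \<longlongrightarrow> 0) (at_right 0)"
    by (rule Lim_transform_eventually)
  moreover have "(flat_exp n \<longlongrightarrow> 0) (at_left 0)"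
  proof (rule Lim_transform_eventually)
    show "((\<lambda>x. 0) \<longlongrightarrow> 0) (at_left 0)" by simp
    show "eventually (\<lambda>x. 0 = flat_exp n x) (at_left (0::real))"
      by (auto simp: eventually_at_filter flat_exp_def)
  qed
  ultimately show ?thesis
    by (simp add: filterlim_split_at)
qed

lemma has_field_derivative_flat_exp:
  "(flat_exp n has_field_derivative (flat_exp (n + 2) x - n * flat_exp (n + 1) x)) (at x)"
proof -
  consider "x < 0" | "x = 0" | "x > 0" by linarith
  then show ?thesis
  proof cases
    case 1
    have "((\<lambda>x. 0) has_field_derivative 0) (at x)" by simp
    then have "(flat_exp n has_field_derivative 0) (at x)"
      by (rule has_field_derivative_transform_within_open[where S = "{..<0}"])
        (use 1 in \<open>auto simp: flat_exp_def\<close>)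
    then show ?thesis using 1 by (simp add: flat_exp_def)
  next
    case 2
    \<comment> \<open>The difference quotient at 0 is the next function of the family, whose limit
      is already known.\<close>
    have "eventually (\<lambda>h. flat_exp (n + 1) h = (flat_exp n (0 + h) - flat_exp n 0) / h) (at 0)"
      by (auto simp: eventually_at_filter flat_exp_def field_simps)
    with flat_exp_tendsto_0[of "n + 1"]
    have "((\<lambda>h. (flat_exp n (0 + h) - flat_exp n 0) / h) \<longlongrightarrow> 0) (at 0)"
      by (rule Lim_transform_eventually)
    then show ?thesis using 2 by (simp add: DERIV_def flat_exp_def)
  next
    case 3
    have d: "((\<lambda>x. inverse x ^ n * exp (- inverse x)) has_field_derivative
        (inverse x ^ (n + 2) * exp (- inverse x) - n * (inverse x ^ (n + 1) * exp (- inverse x)))) (at x)"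
    proof (rule DERIV_cong[OF DERIV_mult[OF DERIV_power[OF DERIV_inverse[of x]]
            DERIV_fun_exp[OF DERIV_minus[OF DERIV_inverse[of x]]]]])
      show "real n * (- (inverse x ^ Suc (Suc 0)) * inverse x ^ (n - Suc 0)) * exp (- inverse x) +
          exp (- inverse x) * - (- (inverse x ^ Suc (Suc 0))) * inverse x ^ n =
        inverse x ^ (n + 2) * exp (- inverse x) - n * (inverse x ^ (n + 1) * exp (- inverse x))"
        by (cases n) (simp_all add: algebra_simps)
    qed (use 3 in auto)
    have "(flat_exp n has_field_derivative
        (inverse x ^ (n + 2) * exp (- inverse x) - n * (inverse x ^ (n + 1) * exp (- inverse x)))) (at x)"
      by (rule has_field_derivative_transform_within_open[OF d, where S = "{0<..}"])
        (use 3 in \<open>auto simp: flat_exp_def\<close>)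
    then show ?thesis using 3 by (simp add: flat_exp_def)
  qed
qed

lemma Ck_on_flat_exp: "Ck_on k UNIV (flat_exp n)"
proof (induction k arbitrary: n)
  case 0
  show ?case
    using has_field_derivative_flat_exp
    by (auto intro!: continuous_at_imp_continuous_on intro: DERIV_isCont)
next
  case (Suc k)
  have mult: "Ck_on k UNIV (\<lambda>x. a x * b x)" if "Ck_on k UNIV a" "Ck_on k UNIV b"
    for a b :: "real \<Rightarrow> real"
    using Ck_on_bilinear[OF open_UNIV bounded_bilinear_mult that] .
  show ?case
  proof (rule Ck_on_SucI[where f' = "\<lambda>x v. (flat_exp (n + 2) x + (- real n) * flat_exp (n + 1) x) * v"])
    show "(flat_exp n has_derivative
        (\<lambda>v. (flat_exp (n + 2) x + (- real n) * flat_exp (n + 1) x) * v)) (at x)" for x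
      using has_field_derivative_flat_exp[of n x] by (simp add: has_field_derivative_def)
    show "Ck_on k UNIV (\<lambda>x. (flat_exp (n + 2) x + (- real n) * flat_exp (n + 1) x) * v)" for v
      by (rule mult[OF Ck_on_add[OF open_UNIV Suc.IH mult[OF Ck_on_const[OF open_UNIV] Suc.IH]]
            Ck_on_const[OF open_UNIV]])
  qed simp
qed

subsection \<open>Smooth functions on open sets\<close>

lemma smooth_on_cong:
  "open U \<Longrightarrow> (\<And>x. x \<in> U \<Longrightarrow> f x = g x) \<Longrightarrow> smooth_on U f \<Longrightarrow> smooth_on U g"
  unfolding smooth_on_def using Ck_on_cong[of U f g] by blast

lemma smooth_on_subset: "smooth_on U f \<Longrightarrow> W \<subseteq> U \<Longrightarrow> smooth_on W f"
  unfolding smooth_on_def using Ck_on_subset by blast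

text \<open>Continuity and differentiability are conditions at single points, so a neighbourhood of
  each point suffices. Fields defined piecewise are glued with this.\<close>

lemma smooth_on_local:
  assumes "\<And>x. x \<in> U \<Longrightarrow> \<exists>W. open W \<and> x \<in> W \<and> smooth_on W f"
  shows "smooth_on U f"
proof -
  have *: "Ck_on k U f" if "\<And>x. x \<in> U \<Longrightarrow> \<exists>W. open W \<and> x \<in> W \<and> Ck_on k W f" for k
    using that
  proof (induction k arbitrary: f)
    case 0
    have "isCont f x" if "x \<in> U" for x
      using 0[OF that] by (auto simp: continuous_on_eq_continuous_at)
    then show ?case by (simp add: continuous_at_imp_continuous_on)
  next
    case (Suc k)
    have "\<forall>x\<in>U. f differentiable (at x)"
      using Suc.prems by (metis Ck_on.simps(2))
    moreover have "Ck_on k U (\<lambda>x. frechet_derivative f (at x) v)" for v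
      by (rule Suc.IH) (metis Suc.prems Ck_on.simps(2))
    ultimately show ?case by simp
  qed
  show ?thesis
    unfolding smooth_on_def
  proof (rule allI, rule *)
    show "\<exists>W. open W \<and> x \<in> W \<and> Ck_on k W f" if "x \<in> U" for k x
      using assms[OF that] unfolding smooth_on_def by auto
  qed
qed

lemma smooth_on_const: "open U \<Longrightarrow> smooth_on U (\<lambda>x. c)"
  unfolding smooth_on_def by (simp add: Ck_on_const)

lemma smooth_on_bounded_linear: "open U \<Longrightarrow> bounded_linear f \<Longrightarrow> smooth_on U f"
  unfolding smooth_on_def by (simp add: Ck_on_bounded_linear)

lemma smooth_on_add:
  "open U \<Longrightarrow> smooth_on U f \<Longrightarrow> smooth_on U g \<Longrightarrow> smooth_on U (\<lambda>x. f x + g x)"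
  unfolding smooth_on_def using Ck_on_add[of U _ f g] by simp

lemma smooth_on_scaleR:
  "open U \<Longrightarrow> smooth_on U f \<Longrightarrow> smooth_on U g \<Longrightarrow> smooth_on U (\<lambda>x. f x *\<^sub>R g x)"
  unfolding smooth_on_def using Ck_on_bilinear[OF _ bounded_bilinear_scaleR, of U _ f g] by simp

lemma smooth_on_mult:
  fixes f g :: "'e::euclidean_space \<Rightarrow> real"
  shows "open U \<Longrightarrow> smooth_on U f \<Longrightarrow> smooth_on U g \<Longrightarrow> smooth_on U (\<lambda>x. f x * g x)"
  unfolding smooth_on_def using Ck_on_bilinear[OF _ bounded_bilinear_mult, of U _ f g] by simp

lemma smooth_on_inner:
  fixes f g :: "'e::euclidean_space \<Rightarrow> 'b::euclidean_space"
  shows "open U \<Longrightarrow> smooth_on U f \<Longrightarrow> smooth_on U g \<Longrightarrow> smooth_on U (\<lambda>x. f x \<bullet> g x)"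
  unfolding smooth_on_def using Ck_on_bilinear[OF _ bounded_bilinear_inner, of U _ f g] by simp

lemma smooth_on_sum:
  "open U \<Longrightarrow> finite I \<Longrightarrow> (\<And>i. i \<in> I \<Longrightarrow> smooth_on U (f i)) \<Longrightarrow> smooth_on U (\<lambda>x. \<Sum>i\<in>I. f i x)"
  unfolding smooth_on_def using Ck_on_sum[of U I _ f] by simp

lemma smooth_on_inverse:
  fixes f :: "'e::euclidean_space \<Rightarrow> real"
  shows "open U \<Longrightarrow> smooth_on U f \<Longrightarrow> (\<And>x. x \<in> U \<Longrightarrow> f x \<noteq> 0) \<Longrightarrow> smooth_on U (\<lambda>x. inverse (f x))"
  unfolding smooth_on_def using Ck_on_inverse[of U _ f] by simp

lemma smooth_on_compose:
  fixes f :: "'e::euclidean_space \<Rightarrow> 'd::euclidean_space" and g :: "'d \<Rightarrow> 'b::real_normed_vector"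
  shows "open U \<Longrightarrow> open W \<Longrightarrow> f ` U \<subseteq> W \<Longrightarrow> smooth_on U f \<Longrightarrow> smooth_on W g \<Longrightarrow>
    smooth_on U (\<lambda>x. g (f x))"
  unfolding smooth_on_def using Ck_on_compose[of U W f _ g] by simp

lemma smooth_on_has_derivative:
  "smooth_on U f \<Longrightarrow> x \<in> U \<Longrightarrow> (f has_derivative frechet_derivative f (at x)) (at x)"
  unfolding smooth_on_def frechet_derivative_works[symmetric]
  by (drule spec[of _ "Suc 0"]) simp

lemma smooth_on_directional:
  "smooth_on U f \<Longrightarrow> smooth_on U (\<lambda>x. frechet_derivative f (at x) v)"
  unfolding smooth_on_def by (rule allI, drule_tac x = "Suc k" in spec) simp

lemma smooth_on_imp_continuous_on: "smooth_on U f \<Longrightarrow> continuous_on U f"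
  unfolding smooth_on_def by (drule spec[of _ 0]) simp

text \<open>Handles differentiation along a vector that moves with the point, as in X(h) and in the
  transformation of a field from one chart to another.\<close>

lemma smooth_on_derivative_apply:
  fixes f :: "'e::euclidean_space \<Rightarrow> 'd::real_normed_vector"
  assumes "open U" "smooth_on U f" "smooth_on U w"
  shows "smooth_on U (\<lambda>x. frechet_derivative f (at x) (w x))"
proof (rule smooth_on_cong[OF assms(1)])
  show "smooth_on U (\<lambda>x. \<Sum>b\<in>Basis. (w x \<bullet> b) *\<^sub>R frechet_derivative f (at x) b)"
    by (rule smooth_on_sum[OF assms(1) finite_Basis], rule smooth_on_scaleR[OF assms(1)
          smooth_on_inner[OF assms(1,3) smooth_on_const[OF assms(1)]] smooth_on_directional[OF assms(2)]])
  show "(\<Sum>b\<in>Basis. (w x \<bullet> b) *\<^sub>R frechet_derivative f (at x) b) = frechet_derivative f (at x) (w x)"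
    if "x \<in> U" for x
    using linear_eq_sum_Basis[of "frechet_derivative f (at x)" "w x"]
      has_derivative_linear[OF smooth_on_has_derivative[OF assms(2) that]] by simp
qed

section \<open>Symmetry of second derivatives\<close>

text \<open>Both iterated derivatives are limits of the same second difference quotient, by two
  applications of the mean value theorem in either order.\<close>

lemma second_difference_mean_value:
  fixes h :: "'e::euclidean_space \<Rightarrow> real"
  assumes "smooth_on U h" "0 < e"
    and U: "\<And>s t. s \<in> {0..e} \<Longrightarrow> t \<in> {0..e} \<Longrightarrow> x + s *\<^sub>R v + t *\<^sub>R w \<in> U"
  shows "\<exists>s\<in>{0..e}. \<exists>t\<in>{0..e}. h (x + e *\<^sub>R v + e *\<^sub>R w) - h (x + e *\<^sub>R v) - h (x + e *\<^sub>R w) + h x =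
    e * e * frechet_derivative (\<lambda>y. frechet_derivative h (at y) v) (at (x + s *\<^sub>R v + t *\<^sub>R w)) w"
proof -
  define d where "d y = frechet_derivative h (at y) v" for y
  have d: "smooth_on U d" unfolding d_def using assms(1) by (rule smooth_on_directional)
  define G where "G s = h (x + s *\<^sub>R v + e *\<^sub>R w) - h (x + s *\<^sub>R v)" for s
  have G': "(G has_field_derivative (d (x + s *\<^sub>R v + e *\<^sub>R w) - d (x + s *\<^sub>R v))) (at s)"
    if "0 \<le> s" "s \<le> e" for s
  proof -
    have *: "((\<lambda>s. h (x + s *\<^sub>R v + t *\<^sub>R w)) has_field_derivative d (x + s *\<^sub>R v + t *\<^sub>R w)) (at s)"
      if t: "t \<in> {0..e}" for t
    proof -
      have hd: "(h has_derivative frechet_derivative h (at (x + s *\<^sub>R v + t *\<^sub>R w)))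
          (at (x + s *\<^sub>R v + t *\<^sub>R w))"
        using smooth_on_has_derivative[OF assms(1)] U t \<open>0 \<le> s\<close> \<open>s \<le> e\<close> by auto
      have "((\<lambda>s. x + s *\<^sub>R v + t *\<^sub>R w) has_derivative (\<lambda>r. r *\<^sub>R v)) (at s)"
        by (auto intro!: derivative_eq_intros)
      from diff_chain_at[OF this hd] show ?thesis
        by (simp add: has_field_derivative_def o_def d_def mult_commute_abs
            linear_cmul[OF has_derivative_linear[OF hd]])
    qed
    from *[of e] *[of 0] \<open>0 < e\<close> show ?thesis
      unfolding G_def by (auto intro: DERIV_diff)
  qed
  obtain s where s: "0 < s" "s < e" "G e - G 0 = e * (d (x + s *\<^sub>R v + e *\<^sub>R w) - d (x + s *\<^sub>R v))"
    using MVT2[OF \<open>0 < e\<close> G'] by auto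
  have D': "((\<lambda>t. d (x + s *\<^sub>R v + t *\<^sub>R w)) has_field_derivative
      frechet_derivative d (at (x + s *\<^sub>R v + t *\<^sub>R w)) w) (at t)" if "0 \<le> t" "t \<le> e" for t
  proof -
    have hd: "(d has_derivative frechet_derivative d (at (x + s *\<^sub>R v + t *\<^sub>R w)))
        (at (x + s *\<^sub>R v + t *\<^sub>R w))"
      using smooth_on_has_derivative[OF d] U that s by auto
    have "((\<lambda>t. x + s *\<^sub>R v + t *\<^sub>R w) has_derivative (\<lambda>r. r *\<^sub>R w)) (at t)"
      by (auto intro!: derivative_eq_intros)
    from diff_chain_at[OF this hd] show ?thesis
      by (simp add: has_field_derivative_def o_def mult_commute_abs
          linear_cmul[OF has_derivative_linear[OF hd]])
  qed
  obtain t where t: "0 < t" "t < e"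
    "d (x + s *\<^sub>R v + e *\<^sub>R w) - d (x + s *\<^sub>R v) = e * frechet_derivative d (at (x + s *\<^sub>R v + t *\<^sub>R w)) w"
    using MVT2[OF \<open>0 < e\<close> D'] by auto
  have "h (x + e *\<^sub>R v + e *\<^sub>R w) - h (x + e *\<^sub>R v) - h (x + e *\<^sub>R w) + h x = G e - G 0"
    by (simp add: G_def)
  also have "\<dots> = e * e * frechet_derivative d (at (x + s *\<^sub>R v + t *\<^sub>R w)) w"
    using s t by simp
  finally show ?thesis
    unfolding d_def[abs_def] using s t by (intro bexI[of _ s] bexI[of _ t]) auto
qed

lemma symmetric_second_derivative:
  fixes h :: "'e::euclidean_space \<Rightarrow> real"
  assumes "open U" "smooth_on U h" "x \<in> U"
  shows "frechet_derivative (\<lambda>y. frechet_derivative h (at y) v) (at x) w =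
    frechet_derivative (\<lambda>y. frechet_derivative h (at y) w) (at x) v"
proof -
  define F where "F v w y = frechet_derivative (\<lambda>y. frechet_derivative h (at y) v) (at y) w" for v w y
  have cont: "isCont (F v w) x" for v w
    using smooth_on_imp_continuous_on[OF smooth_on_directional[OF smooth_on_directional[OF assms(2)]]]
      assms(1,3) unfolding F_def by (simp add: continuous_on_eq_continuous_at)
  have "\<bar>F v w x - F w v x\<bar> \<le> 0 + r" if "0 < r" for r
  proof -
    obtain d1 where d1: "d1 > 0" "\<And>y. dist y x < d1 \<Longrightarrow> dist (F v w y) (F v w x) < r / 2"
      using cont[of v w] \<open>0 < r\<close> unfolding continuous_at_eps_delta
      by (metis half_gt_zero)
    obtain d2 where d2: "d2 > 0" "\<And>y. dist y x < d2 \<Longrightarrow> dist (F w v y) (F w v x) < r / 2"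
      using cont[of w v] \<open>0 < r\<close> unfolding continuous_at_eps_delta
      by (metis half_gt_zero)
    obtain d3 where d3: "d3 > 0" "ball x d3 \<subseteq> U"
      using assms open_contains_ball by blast
    define d where "d = min d1 (min d2 d3)"
    have d: "0 < d" using d1 d2 d3 by (simp add: d_def)
    \<comment> \<open>With side length e = d / (2 m) the whole parallelogram spanned by e v and e w
      stays within d / 2 of x; the summand 1 keeps m positive when v and w vanish.\<close>
    define m where "m = norm v + norm w + 1"
    define e where "e = d / (2 * m)"
    have n0: "m > 0" by (simp add: m_def add_nonneg_pos)
    have e: "0 < e" using d n0 by (simp add: e_def)
    have near: "dist (x + s *\<^sub>R v + t *\<^sub>R w) x < d" if "s \<in> {0..e}" "t \<in> {0..e}" for s t
    proof -
      have "dist (x + s *\<^sub>R v + t *\<^sub>R w) x \<le> s * norm v + t * norm w"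
        using that by (auto simp: dist_norm add.assoc intro: norm_triangle_le)
      also have "\<dots> \<le> e * norm v + e * norm w"
        using that by (intro add_mono mult_right_mono) auto
      also have "\<dots> \<le> e * m" using e by (simp add: m_def algebra_simps)
      also have "\<dots> = d / 2" using n0 by (simp add: e_def)
      finally show ?thesis using d by simp
    qed
    have inU: "x + s *\<^sub>R v + t *\<^sub>R w \<in> U" if "s \<in> {0..e}" "t \<in> {0..e}" for s t
      using near[OF that] d3 by (auto simp: d_def dist_commute)
    obtain s t where st: "s \<in> {0..e}" "t \<in> {0..e}"
      "h (x + e *\<^sub>R v + e *\<^sub>R w) - h (x + e *\<^sub>R v) - h (x + e *\<^sub>R w) + h x =
        e * e * F v w (x + s *\<^sub>R v + t *\<^sub>R w)"
      using second_difference_mean_value[OF assms(2) e inU] unfolding F_def by blast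
    \<comment> \<open>Exchanging v and w leaves the second difference unchanged, but the mean value
      theorem now expresses it by the other mixed derivative.\<close>
    have inU': "x + s *\<^sub>R w + t *\<^sub>R v \<in> U" if "s \<in> {0..e}" "t \<in> {0..e}" for s t
      using inU[OF that(2,1)] by (simp add: algebra_simps)
    obtain s' t' where st': "s' \<in> {0..e}" "t' \<in> {0..e}"
      "h (x + e *\<^sub>R w + e *\<^sub>R v) - h (x + e *\<^sub>R w) - h (x + e *\<^sub>R v) + h x =
        e * e * F w v (x + s' *\<^sub>R w + t' *\<^sub>R v)"
      using second_difference_mean_value[OF assms(2) e inU'] unfolding F_def by blast
    have "F v w (x + s *\<^sub>R v + t *\<^sub>R w) = F w v (x + t' *\<^sub>R v + s' *\<^sub>R w)"
      using st(3) st'(3) e by (simp add: algebra_simps)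
    moreover have "dist (F v w (x + s *\<^sub>R v + t *\<^sub>R w)) (F v w x) < r / 2"
      using near[OF st(1,2)] d1 by (simp add: d_def)
    moreover have "dist (F w v (x + t' *\<^sub>R v + s' *\<^sub>R w)) (F w v x) < r / 2"
      using near[OF st'(2,1)] d2 by (simp add: d_def)
    ultimately show ?thesis unfolding dist_real_def by linarith
  qed
  then have "\<bar>F v w x - F w v x\<bar> \<le> 0" by (rule field_le_epsilon)
  then show ?thesis by (simp add: F_def)
qed

section \<open>Bump functions and fields on manifolds\<close>

text \<open>Compose \<open>flat_exp 0\<close> with r^2 - |x - x0|^2, which is positive at the centre
  and at most 0 off the ball, and divide by the value at the centre.\<close>

lemma exists_smooth_bump:
  fixes x0 :: "'e::euclidean_space"
  assumes "0 < r"
  obtains B :: "'e \<Rightarrow> real"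
  where "smooth_on UNIV B" "B x0 = 1" "\<And>x. x \<notin> cball x0 r \<Longrightarrow> B x = 0"
proof -
  define q where "q x = r\<^sup>2 + (-1) * ((x + (- x0)) \<bullet> (x + (- x0)))" for x :: 'e
  define B where "B x = inverse (flat_exp 0 (r\<^sup>2)) * flat_exp 0 (q x)" for x
  have id: "smooth_on UNIV (\<lambda>x::'e. x + (- x0))"
    by (rule smooth_on_add[OF open_UNIV smooth_on_bounded_linear[OF open_UNIV bounded_linear_ident]
          smooth_on_const[OF open_UNIV]])
  have q: "smooth_on UNIV q"
    unfolding q_def
    by (rule smooth_on_add[OF open_UNIV smooth_on_const[OF open_UNIV] smooth_on_mult[OF open_UNIV
          smooth_on_const[OF open_UNIV] smooth_on_inner[OF open_UNIV id id]]])
  have "smooth_on UNIV (flat_exp 0)"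
    unfolding smooth_on_def using Ck_on_flat_exp by blast
  from smooth_on_compose[OF open_UNIV open_UNIV _ q this]
  have "smooth_on UNIV (\<lambda>x. flat_exp 0 (q x))" by simp
  then have "smooth_on UNIV B"
    unfolding B_def by (rule smooth_on_mult[OF open_UNIV smooth_on_const[OF open_UNIV]])
  moreover have "B x0 = 1"
    using assms by (simp add: B_def q_def flat_exp_def)
  moreover have "B x = 0" if "x \<notin> cball x0 r" for x
  proof -
    have "r\<^sup>2 \<le> (norm (x - x0))\<^sup>2"
      using that assms by (intro power_mono) (auto simp: dist_norm norm_minus_commute)
    then have "q x \<le> 0" by (simp add: q_def power2_norm_eq_inner)
    then show ?thesis by (simp add: B_def flat_exp_def)
  qed
  ultimately show ?thesis by (rule that)
qed

locale smooth_manifold =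
  fixes A :: "('a::t2_space, 'e::euclidean_space) chart set"
  assumes atlas: "smooth_atlas A"
begin

abbreviation smoothf :: "('a \<Rightarrow> real) \<Rightarrow> bool" where "smoothf \<equiv> smooth_fun A"
abbreviation field :: "('a \<Rightarrow> 'e) \<Rightarrow> bool" where "field \<equiv> vector_field A"
abbreviation der :: "('a \<Rightarrow> 'e) \<Rightarrow> ('a \<Rightarrow> real) \<Rightarrow> 'a \<Rightarrow> real" where "der \<equiv> vf_deriv A"

section \<open>Charts and the Jacobians between them\<close>

lemma open_chart: "c \<in> A \<Longrightarrow> open (fst c)" "c \<in> A \<Longrightarrow> open (snd c ` fst c)"
  using atlas unfolding smooth_atlas_def by auto

lemma chart_homeomorphism:
  "c \<in> A \<Longrightarrow> homeomorphism (fst c) (snd c ` fst c) (snd c) (chart_inv c)"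
  using atlas unfolding smooth_atlas_def by auto

lemma chart_inv_chart: "c \<in> A \<Longrightarrow> q \<in> fst c \<Longrightarrow> chart_inv c (snd c q) = q"
  using homeomorphism_apply1[OF chart_homeomorphism] .

lemma chart_chart_inv: "c \<in> A \<Longrightarrow> x \<in> snd c ` fst c \<Longrightarrow> snd c (chart_inv c x) = x"
  using homeomorphism_apply2[OF chart_homeomorphism] .

lemma chart_inv_mem: "c \<in> A \<Longrightarrow> x \<in> snd c ` fst c \<Longrightarrow> chart_inv c x \<in> fst c"
  using chart_inv_chart[of c] by auto

lemma chart_at_mem: "chart_at A p \<in> A" "p \<in> fst (chart_at A p)"
proof -
  have "\<exists>c. c \<in> A \<and> p \<in> fst c" using atlas unfolding smooth_atlas_def by (metis UNIV_I UN_E)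
  then have "chart_at A p \<in> A \<and> p \<in> fst (chart_at A p)"
    unfolding chart_at_def by (rule someI_ex)
  then show "chart_at A p \<in> A" "p \<in> fst (chart_at A p)" by auto
qed

lemma open_chart_image:
  assumes "c \<in> A" "open W"
  shows "open (snd c ` (fst c \<inter> W))"
proof -
  have "snd c ` (fst c \<inter> W) = (snd c ` fst c) \<inter> chart_inv c -` W"
    using chart_inv_chart[OF assms(1)] by auto
  moreover have "continuous_on (snd c ` fst c) (chart_inv c)"
    using chart_homeomorphism[OF assms(1)] by (simp add: homeomorphism_def)
  ultimately show ?thesis
    using continuous_open_preimage[OF _ open_chart(2)[OF assms(1)] assms(2)] by simp
qed

lemma smooth_transition:
  "c \<in> A \<Longrightarrow> d \<in> A \<Longrightarrow> smooth_on (snd c ` (fst c \<inter> fst d)) (\<lambda>x. snd d (chart_inv c x))"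
  using atlas unfolding smooth_atlas_def by (auto simp: o_def)

definition jac :: "('a, 'e) chart \<Rightarrow> ('a, 'e) chart \<Rightarrow> 'a \<Rightarrow> 'e \<Rightarrow> 'e" where
  "jac c d p = frechet_derivative (\<lambda>x. snd d (chart_inv c x)) (at (snd c p))"

lemma components_eq_jac: "components A c p v = jac (chart_at A p) c p v"
  by (simp add: components_def jac_def o_def)

lemma has_derivative_transition:
  assumes "c \<in> A" "d \<in> A" "p \<in> fst c" "p \<in> fst d"
  shows "((\<lambda>x. snd d (chart_inv c x)) has_derivative jac c d p) (at (snd c p))"
  unfolding jac_def using assms by (intro smooth_on_has_derivative[OF smooth_transition]) auto

lemma linear_jac: "c \<in> A \<Longrightarrow> d \<in> A \<Longrightarrow> p \<in> fst c \<Longrightarrow> p \<in> fst d \<Longrightarrow> linear (jac c d p)"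
  by (rule has_derivative_linear[OF has_derivative_transition])

text \<open>Taking \<open>h\<close> to be a third coordinate map yields the cocycle identity of the Jacobians.\<close>

lemma has_derivative_change_chart:
  fixes h :: "'a \<Rightarrow> 'b::real_normed_vector"
  assumes "c \<in> A" "d \<in> A" "p \<in> fst c" "p \<in> fst d"
    and "((\<lambda>x. h (chart_inv d x)) has_derivative L) (at (snd d p))"
  shows "((\<lambda>x. h (chart_inv c x)) has_derivative (\<lambda>v. L (jac c d p v))) (at (snd c p))"
proof (rule has_derivative_transform_within_open[where s = "snd c ` (fst c \<inter> fst d)"])
  have "((\<lambda>x. h (chart_inv d x)) has_derivative L) (at (snd d (chart_inv c (snd c p))))"
    using assms chart_inv_chart by simp
  from diff_chain_at[OF has_derivative_transition[OF assms(1-4)] this]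
  show "((\<lambda>x. h (chart_inv d (snd d (chart_inv c x)))) has_derivative (\<lambda>v. L (jac c d p v)))
      (at (snd c p))"
    by (simp add: o_def)
qed (use assms open_chart_image[OF assms(1) open_chart(1)[OF assms(2)]] chart_inv_chart[OF assms(1)]
      chart_inv_chart[OF assms(2)] in auto)

lemma jac_jac:
  assumes "c \<in> A" "d \<in> A" "e \<in> A" "p \<in> fst c" "p \<in> fst d" "p \<in> fst e"
  shows "jac d e p (jac c d p v) = jac c e p v"
proof -
  have "(\<lambda>v. jac d e p (jac c d p v)) = jac c e p"
    using has_derivative_change_chart[OF assms(1,2,4,5) has_derivative_transition[OF assms(2,3,5,6)]]
      has_derivative_transition[OF assms(1,3,4,6)] by (rule has_derivative_unique)
  then show ?thesis by (rule fun_cong)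
qed

lemma jac_self:
  assumes "c \<in> A" "p \<in> fst c"
  shows "jac c c p v = v"
proof -
  have "((\<lambda>x. snd c (chart_inv c x)) has_derivative (\<lambda>v. v)) (at (snd c p))"
    by (rule has_derivative_transform_within_open[OF has_derivative_ident open_chart(2)])
      (use assms chart_chart_inv[OF assms(1)] in auto)
  then have "jac c c p = (\<lambda>v. v)"
    using has_derivative_transition[OF assms(1,1,2,2)] has_derivative_unique by blast
  then show ?thesis by simp
qed

lemma linear_components: "c \<in> A \<Longrightarrow> p \<in> fst c \<Longrightarrow> linear (components A c p)"
  unfolding components_eq_jac using linear_jac chart_at_mem by auto

lemma components_chart_at: "components A (chart_at A p) p v = v"
  by (simp add: components_eq_jac jac_self chart_at_mem)

subsection \<open>Smooth functions and vector fields\<close>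

lemma smooth_funI:
  "(\<And>c. c \<in> A \<Longrightarrow> smooth_on (snd c ` fst c) (\<lambda>x. h (chart_inv c x))) \<Longrightarrow> smoothf h"
  by (simp add: smooth_fun_def o_def)

lemma smooth_funD: "smoothf h \<Longrightarrow> c \<in> A \<Longrightarrow> smooth_on (snd c ` fst c) (\<lambda>x. h (chart_inv c x))"
  by (simp add: smooth_fun_def o_def)

lemma vector_fieldD: "field X \<Longrightarrow> c \<in> A \<Longrightarrow>
    smooth_on (snd c ` fst c) (\<lambda>x. components A c (chart_inv c x) (X (chart_inv c x)))"
  by (simp add: vector_field_def)

lemma smooth_fun_const: "smoothf (\<lambda>p. a)"
  by (rule smooth_funI) (simp add: smooth_on_const open_chart)

lemma smooth_fun_add: "smoothf h \<Longrightarrow> smoothf k \<Longrightarrow> smoothf (\<lambda>p. h p + k p)"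
  by (rule smooth_funI) (simp add: smooth_on_add open_chart smooth_funD)

lemma smooth_fun_mult: "smoothf h \<Longrightarrow> smoothf k \<Longrightarrow> smoothf (\<lambda>p. h p * k p)"
  by (rule smooth_funI) (simp add: smooth_on_mult open_chart smooth_funD)

lemma smooth_fun_minus: "smoothf h \<Longrightarrow> smoothf (\<lambda>p. - h p)"
  using smooth_fun_mult[OF smooth_fun_const[of "-1"]] by simp

lemma smooth_fun_diff: "smoothf h \<Longrightarrow> smoothf k \<Longrightarrow> smoothf (\<lambda>p. h p - k p)"
  using smooth_fun_add[OF _ smooth_fun_minus] by simp

lemma smooth_fun_sum: "finite I \<Longrightarrow> (\<And>i. i \<in> I \<Longrightarrow> smoothf (h i)) \<Longrightarrow> smoothf (\<lambda>p. \<Sum>i\<in>I. h i p)"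
  by (induction I rule: finite_induct) (auto intro: smooth_fun_const smooth_fun_add)

lemma smooth_fun_power2: "smoothf h \<Longrightarrow> smoothf (\<lambda>p. (h p)\<^sup>2)"
  unfolding power2_eq_square by (rule smooth_fun_mult)

text \<open>Near the given point \<rho> has no zero, and \<open>h\<close> is recovered by dividing
  by it. This removes the cut-off factor from quantities that are computed in a frame multiplied by
  a bump function.\<close>

lemma smooth_fun_if_multiple:
  assumes "\<And>p. \<exists>\<rho>. smoothf \<rho> \<and> \<rho> p \<noteq> 0 \<and> smoothf (\<lambda>q. \<rho> q * h q)"
  shows "smoothf h"
proof (rule smooth_funI, rule smooth_on_local)
  fix c x assume c: "c \<in> A" and x: "x \<in> snd c ` fst c"
  obtain \<rho> where \<rho>: "smoothf \<rho>" "\<rho> (chart_inv c x) \<noteq> 0" "smoothf (\<lambda>q. \<rho> q * h q)"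
    using assms by blast
  let ?r = "\<lambda>y. \<rho> (chart_inv c y)"
  define W where "W = snd c ` fst c \<inter> ?r -` (- {0})"
  have "continuous_on (snd c ` fst c) ?r"
    by (rule smooth_on_imp_continuous_on[OF smooth_funD[OF \<rho>(1) c]])
  then have W: "open W"
    unfolding W_def by (rule continuous_open_preimage[OF _ open_chart(2)[OF c]]) auto
  have sub: "W \<subseteq> snd c ` fst c" by (auto simp: W_def)
  have "smooth_on W (\<lambda>y. inverse (?r y) * (?r y * h (chart_inv c y)))"
    by (intro smooth_on_mult[OF W] smooth_on_inverse[OF W]
        smooth_on_subset[OF smooth_funD[OF \<rho>(1) c] sub]
        smooth_on_subset[OF smooth_funD[OF \<rho>(3) c] sub]) (simp add: W_def)
  then have "smooth_on W (\<lambda>y. h (chart_inv c y))"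
    by (rule smooth_on_cong[OF W, rotated]) (simp add: W_def)
  then show "\<exists>W. open W \<and> x \<in> W \<and> smooth_on W (\<lambda>y. h (chart_inv c y))"
    using W x \<rho>(2) by (intro exI[of _ W]) (auto simp: W_def)
qed

lemma vector_field_add:
  assumes "field X" "field Y"
  shows "field (\<lambda>p. X p + Y p)"
  unfolding vector_field_def
proof
  fix c assume c: "c \<in> A"
  show "smooth_on (snd c ` fst c)
      (\<lambda>x. components A c (chart_inv c x) (X (chart_inv c x) + Y (chart_inv c x)))"
    by (rule smooth_on_cong[OF open_chart(2)[OF c] _ smooth_on_add[OF open_chart(2)[OF c]
            vector_fieldD[OF assms(1) c] vector_fieldD[OF assms(2) c]]])
      (use c chart_inv_mem in \<open>auto simp: linear_add[OF linear_components]\<close>)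
qed

lemma vector_field_scaleR:
  assumes "smoothf h" "field X"
  shows "field (\<lambda>p. h p *\<^sub>R X p)"
  unfolding vector_field_def
proof
  fix c assume c: "c \<in> A"
  show "smooth_on (snd c ` fst c)
      (\<lambda>x. components A c (chart_inv c x) (h (chart_inv c x) *\<^sub>R X (chart_inv c x)))"
    by (rule smooth_on_cong[OF open_chart(2)[OF c] _ smooth_on_scaleR[OF open_chart(2)[OF c]
            smooth_funD[OF assms(1) c] vector_fieldD[OF assms(2) c]]])
      (use c chart_inv_mem in \<open>auto simp: linear_cmul[OF linear_components]\<close>)
qed

lemma vector_field_minus: "field X \<Longrightarrow> field (\<lambda>p. - X p)"
  using vector_field_scaleR[OF smooth_fun_const[of "-1"]] by simp

lemma vector_field_diff: "field X \<Longrightarrow> field Y \<Longrightarrow> field (\<lambda>p. X p - Y p)"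
  using vector_field_add[OF _ vector_field_minus] by simp

lemma vector_field_zero: "field (\<lambda>p. 0)"
  unfolding vector_field_def
proof
  fix c assume c: "c \<in> A"
  show "smooth_on (snd c ` fst c) (\<lambda>x. components A c (chart_inv c x) 0)"
    by (rule smooth_on_cong[OF open_chart(2)[OF c] _ smooth_on_const[OF open_chart(2)[OF c]]])
      (use c chart_inv_mem in \<open>auto simp: linear_0[OF linear_components]\<close>)
qed

lemma vector_field_sum: "finite I \<Longrightarrow> (\<And>i. i \<in> I \<Longrightarrow> field (X i)) \<Longrightarrow> field (\<lambda>p. \<Sum>i\<in>I. X i p)"
  by (induction I rule: finite_induct) (auto intro: vector_field_zero vector_field_add)

subsection \<open>The action of vector fields on functions\<close>

lemma has_derivative_chart:
  assumes "smoothf h" "c \<in> A" "p \<in> fst c"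
  shows "((\<lambda>x. h (chart_inv c x)) has_derivative
    frechet_derivative (\<lambda>x. h (chart_inv c x)) (at (snd c p))) (at (snd c p))"
  using assms by (intro smooth_on_has_derivative[OF smooth_funD]) auto

lemma has_derivative_differential:
  assumes "smoothf h"
  shows "((\<lambda>x. h (chart_inv (chart_at A p) x)) has_derivative differential A h p)
    (at (snd (chart_at A p) p))"
  using has_derivative_chart[OF assms chart_at_mem]
  unfolding differential_def[abs_def] by (simp add: o_def)

lemma differential_chart:
  assumes "smoothf h" "c \<in> A" "p \<in> fst c"
  shows "differential A h p v =
    frechet_derivative (\<lambda>x. h (chart_inv c x)) (at (snd c p)) (components A c p v)"
proof -
  from has_derivative_change_chart[OF chart_at_mem(1) assms(2) chart_at_mem(2) assms(3)
      has_derivative_chart[OF assms]]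
  have "differential A h p = (\<lambda>v. frechet_derivative (\<lambda>x. h (chart_inv c x)) (at (snd c p))
      (jac (chart_at A p) c p v))"
    using has_derivative_differential[OF assms(1)] has_derivative_unique by blast
  then show ?thesis by (simp add: components_eq_jac)
qed

lemma linear_differential: "smoothf h \<Longrightarrow> linear (differential A h p)"
  by (rule has_derivative_linear[OF has_derivative_differential])

lemma vf_deriv_chart:
  assumes "smoothf h" "c \<in> A" "x \<in> snd c ` fst c"
  shows "der X h (chart_inv c x) = frechet_derivative (\<lambda>x. h (chart_inv c x)) (at x)
      (components A c (chart_inv c x) (X (chart_inv c x)))"
  unfolding vf_deriv_def
  using differential_chart[OF assms(1,2) chart_inv_mem[OF assms(2,3)]]
  by (simp add: chart_chart_inv assms)

lemma smooth_fun_vf_deriv: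
  assumes "field X" "smoothf h"
  shows "smoothf (der X h)"
proof (rule smooth_funI)
  fix c assume c: "c \<in> A"
  show "smooth_on (snd c ` fst c) (\<lambda>x. der X h (chart_inv c x))"
    by (rule smooth_on_cong[OF open_chart(2)[OF c] _ smooth_on_derivative_apply[OF open_chart(2)[OF c]
            smooth_funD[OF assms(2) c] vector_fieldD[OF assms(1) c]]])
      (simp add: vf_deriv_chart assms c)
qed

lemma vf_deriv_const: "der X (\<lambda>p. a) p = 0"
  by (simp add: vf_deriv_def differential_def o_def)

lemma vf_deriv_add:
  assumes "smoothf h" "smoothf k"
  shows "der X (\<lambda>p. h p + k p) p = der X h p + der X k p"
proof -
  have "differential A (\<lambda>p. h p + k p) p = (\<lambda>v. differential A h p v + differential A k p v)"
    using has_derivative_differential[OF smooth_fun_add[OF assms]]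
      has_derivative_add[OF assms[THEN has_derivative_differential]] has_derivative_unique by blast
  then show ?thesis by (simp add: vf_deriv_def)
qed

lemma vf_deriv_mult:
  assumes "smoothf h" "smoothf k"
  shows "der X (\<lambda>p. h p * k p) p = der X h p * k p + h p * der X k p"
proof -
  have "differential A (\<lambda>p. h p * k p) p = (\<lambda>v. h p * differential A k p v + differential A h p v * k p)"
    using has_derivative_differential[OF smooth_fun_mult[OF assms], of p]
      has_derivative_mult[OF assms[THEN has_derivative_differential], of p] has_derivative_unique
    by (auto simp: chart_inv_chart chart_at_mem)
  then show ?thesis by (simp add: vf_deriv_def)
qed

lemma vf_deriv_cmult: "smoothf h \<Longrightarrow> der X (\<lambda>p. a * h p) p = a * der X h p"
  using vf_deriv_mult[OF smooth_fun_const] vf_deriv_const by simp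

lemma vf_deriv_minus: "smoothf h \<Longrightarrow> der X (\<lambda>p. - h p) p = - der X h p"
  using vf_deriv_cmult[of h X "-1"] by simp

lemma vf_deriv_diff:
  "smoothf h \<Longrightarrow> smoothf k \<Longrightarrow> der X (\<lambda>p. h p - k p) p = der X h p - der X k p"
  using vf_deriv_add[OF _ smooth_fun_minus] vf_deriv_minus by simp

lemma vf_deriv_sum:
  "finite I \<Longrightarrow> (\<And>i. i \<in> I \<Longrightarrow> smoothf (h i)) \<Longrightarrow> der X (\<lambda>p. \<Sum>i\<in>I. h i p) p = (\<Sum>i\<in>I. der X (h i) p)"
  by (induction I rule: finite_induct) (auto simp: vf_deriv_const vf_deriv_add smooth_fun_sum)

lemma vf_deriv_field_add: "smoothf h \<Longrightarrow> der (\<lambda>p. X p + Y p) h p = der X h p + der Y h p"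
  by (simp add: vf_deriv_def linear_add[OF linear_differential])

lemma vf_deriv_field_diff: "smoothf h \<Longrightarrow> der (\<lambda>p. X p - Y p) h p = der X h p - der Y h p"
  by (simp add: vf_deriv_def linear_diff[OF linear_differential])

lemma vf_deriv_field_scaleR: "smoothf h \<Longrightarrow> der (\<lambda>p. k p *\<^sub>R X p) h p = k p * der X h p"
  by (simp add: vf_deriv_def linear_cmul[OF linear_differential])

text \<open>In a chart the derivative vanishes on a ball, which is convex, so \<open>h\<close> is
  locally constant; connectedness does the rest.\<close>

lemma constant_if_differential_zero:
  assumes "connected (UNIV :: 'a set)" "smoothf h" "\<And>p v. differential A h p v = 0"
  shows "h p = h q"
proof (rule connected_local_const[OF assms(1) UNIV_I UNIV_I], rule ballI)
  fix a
  define c where "c = chart_at A a"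
  have c: "c \<in> A" "a \<in> fst c" by (auto simp: c_def chart_at_mem)
  obtain r where r: "0 < r" "ball (snd c a) r \<subseteq> snd c ` fst c"
    using open_chart(2)[OF c(1)] c(2) open_contains_ball by blast
  have "((\<lambda>x. h (chart_inv c x)) has_derivative (\<lambda>v. 0)) (at x within ball (snd c a) r)"
    if x: "x \<in> ball (snd c a) r" for x
  proof -
    define b where "b = chart_inv c x"
    have b: "b \<in> fst c" "snd c b = x"
      using subsetD[OF r(2) x] chart_inv_mem[OF c(1)] chart_chart_inv[OF c(1)] by (auto simp: b_def)
    have "((\<lambda>x. h (chart_inv c x)) has_derivative (\<lambda>v. differential A h b (jac c (chart_at A b) b v)))
        (at (snd c b))"
      by (rule has_derivative_change_chart[OF c(1) chart_at_mem(1) b(1) chart_at_mem(2)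
            has_derivative_differential[OF assms(2)]])
    then show ?thesis using assms(3) b by (simp add: has_derivative_at_withinI)
  qed
  then have "\<exists>l. \<forall>x\<in>ball (snd c a) r. h (chart_inv c x) = l"
    using has_derivative_zero_constant[OF convex_ball] by blast
  then obtain l where l: "\<And>x. x \<in> ball (snd c a) r \<Longrightarrow> h (chart_inv c x) = l" by blast
  define W where "W = fst c \<inter> snd c -` ball (snd c a) r"
  have "continuous_on (fst c) (snd c)"
    using chart_homeomorphism[OF c(1)] by (simp add: homeomorphism_def)
  then have "open W"
    unfolding W_def by (rule continuous_open_preimage[OF _ open_chart(1)[OF c(1)] open_ball])
  moreover have aW: "a \<in> W" using c r by (simp add: W_def)
  moreover have "h b = l" if "b \<in> W" for b
    using l[of "snd c b"] that chart_inv_chart[OF c(1)] by (simp add: W_def)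
  ultimately have "\<forall>\<^sub>F b in nhds a. h a = h b"
    unfolding eventually_nhds by metis
  then show "eventually (\<lambda>b. h a = h b) (at a within UNIV)"
    by (simp add: eventually_at_filter eventually_mono)
qed

subsection \<open>Extension by zero\<close>

text \<open>The Hausdorff property enters here only: it makes the compact set closed.\<close>

lemma closed_chart_inv_cball:
  assumes "c \<in> A" "cball x0 r \<subseteq> snd c ` fst c"
  shows "closed (chart_inv c ` cball x0 r)"
proof -
  have "continuous_on (snd c ` fst c) (chart_inv c)"
    using chart_homeomorphism[OF assms(1)] by (simp add: homeomorphism_def)
  then have "compact (chart_inv c ` cball x0 r)"
    using assms(2) by (intro compact_continuous_image) (auto intro: continuous_on_subset)
  then show ?thesis by (rule compact_imp_closed)
qed

text \<open>Two open sets cover the domain of \<open>d\<close>: its part inside the domain of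
  \<open>c\<close>, where \<open>F\<close> is smooth by assumption, and the complement of the closed
  image of the ball, where \<open>F\<close> is zero.\<close>

lemma smooth_on_extend_by_zero:
  fixes F :: "'e \<Rightarrow> 'b::real_normed_vector"
  assumes c: "c \<in> A" "cball x0 r \<subseteq> snd c ` fst c" and d: "d \<in> A"
    and inside: "smooth_on (snd d ` (fst d \<inter> fst c)) F"
    and outside: "\<And>q. q \<in> fst d \<Longrightarrow> q \<notin> chart_inv c ` cball x0 r \<Longrightarrow> F (snd d q) = 0"
  shows "smooth_on (snd d ` fst d) F"
proof (rule smooth_on_local)
  let ?K = "chart_inv c ` cball x0 r"
  fix x assume x: "x \<in> snd d ` fst d"
  then obtain q where q: "q \<in> fst d" "x = snd d q" by auto
  show "\<exists>W. open W \<and> x \<in> W \<and> smooth_on W F"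
  proof (cases "q \<in> fst c")
    case True
    then show ?thesis
      using inside q open_chart_image[OF d open_chart(1)[OF c(1)]] by blast
  next
    case False
    have "?K \<subseteq> fst c" using c(2) chart_inv_mem[OF c(1)] by blast
    then have "q \<notin> ?K" using False by auto
    have op: "open (snd d ` (fst d \<inter> - ?K))"
      using open_chart_image[OF d] closed_chart_inv_cball[OF c] by blast
    have "smooth_on (snd d ` (fst d \<inter> - ?K)) F"
      by (rule smooth_on_cong[OF op _ smooth_on_const[OF op, of 0]]) (use outside in auto)
    then show ?thesis using op q \<open>q \<notin> ?K\<close> by blast
  qed
qed

lemma smooth_on_compose_transition:
  assumes c: "c \<in> A" and d: "d \<in> A" and u: "smooth_on (snd c ` fst c) u"
  shows "smooth_on (snd d ` (fst d \<inter> fst c)) (\<lambda>x. u (snd c (chart_inv d x)))"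
  by (rule smooth_on_compose[OF open_chart_image[OF d open_chart(1)[OF c]] open_chart(2)[OF c] _
        smooth_transition[OF d c] u])
    (use chart_inv_chart[OF d] in auto)

lemma smooth_fun_extend_by_zero:
  assumes c: "c \<in> A" "cball x0 r \<subseteq> snd c ` fst c" and u: "smooth_on (snd c ` fst c) u"
    and zero: "\<And>x. x \<in> snd c ` fst c \<Longrightarrow> x \<notin> cball x0 r \<Longrightarrow> u x = 0"
  shows "smoothf (\<lambda>q. if q \<in> fst c then u (snd c q) else 0)"
proof (rule smooth_funI)
  fix d assume d: "d \<in> A"
  let ?F = "\<lambda>x. if chart_inv d x \<in> fst c then u (snd c (chart_inv d x)) else 0"
  show "smooth_on (snd d ` fst d) ?F"
  proof (rule smooth_on_extend_by_zero[OF c d])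
    show "smooth_on (snd d ` (fst d \<inter> fst c)) ?F"
      by (rule smooth_on_cong[OF open_chart_image[OF d open_chart(1)[OF c(1)]] _
            smooth_on_compose_transition[OF c(1) d u]])
        (use chart_inv_chart[OF d] in auto)
    show "?F (snd d q) = 0" if q: "q \<in> fst d" "q \<notin> chart_inv c ` cball x0 r" for q
    proof (cases "q \<in> fst c")
      case True
      then have "snd c q \<notin> cball x0 r"
        using q(2) chart_inv_chart[OF c(1) True] by (metis imageI)
      then show ?thesis
        using zero[of "snd c q"] True q(1) chart_inv_chart[OF d] by simp
    qed (simp add: chart_inv_chart[OF d q(1)])
  qed
qed

text \<open>\<open>w\<close> gives components in the chart \<open>c\<close>, but the value of a
  field at \<open>q\<close> is stored in the chart chosen for \<open>q\<close>; the factor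
  \<open>jac c (chart_at A q) q\<close> translates between the two.\<close>

lemma vector_field_extend_by_zero:
  assumes c: "c \<in> A" "cball x0 r \<subseteq> snd c ` fst c" and w: "smooth_on (snd c ` fst c) w"
    and zero: "\<And>x. x \<in> snd c ` fst c \<Longrightarrow> x \<notin> cball x0 r \<Longrightarrow> w x = 0"
  shows "field (\<lambda>q. if q \<in> fst c then jac c (chart_at A q) q (w (snd c q)) else 0)"
    (is "field ?X")
  unfolding vector_field_def
proof
  fix d assume d: "d \<in> A"
  let ?F = "\<lambda>x. components A d (chart_inv d x) (?X (chart_inv d x))"
  have op: "open (snd d ` (fst d \<inter> fst c))"
    using open_chart_image[OF d open_chart(1)[OF c(1)]] .
  show "smooth_on (snd d ` fst d) ?F"
  proof (rule smooth_on_extend_by_zero[OF c d])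
    let ?y = "\<lambda>x. snd c (chart_inv d x)"
    define t where "t x = snd d (chart_inv c x)" for x
    have opc: "open (snd c ` (fst c \<inter> fst d))"
      using open_chart_image[OF c(1) open_chart(1)[OF d]] .
    have "smooth_on (snd c ` (fst c \<inter> fst d)) (\<lambda>y. frechet_derivative t (at y) (w y))"
      unfolding t_def
      by (rule smooth_on_derivative_apply[OF opc smooth_transition[OF c(1) d]])
        (rule smooth_on_subset[OF w], auto)
    from smooth_on_compose[OF op opc _ smooth_transition[OF d c(1)] this]
    have *: "smooth_on (snd d ` (fst d \<inter> fst c)) (\<lambda>x. frechet_derivative t (at (?y x)) (w (?y x)))"
      using chart_inv_chart[OF d] by (auto simp: image_image)
    show "smooth_on (snd d ` (fst d \<inter> fst c)) ?F"
    proof (rule smooth_on_cong[OF op _ *])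
      fix x assume "x \<in> snd d ` (fst d \<inter> fst c)"
      then have q: "chart_inv d x \<in> fst d" "chart_inv d x \<in> fst c"
        using chart_inv_chart[OF d] by auto
      \<comment> \<open>The cocycle identity eliminates the chart chosen for the point, which need
        not depend continuously on it.\<close>
      have "?F x = jac c d (chart_inv d x) (w (?y x))"
        using q by (simp add: components_eq_jac jac_jac c d chart_at_mem)
      then show "frechet_derivative t (at (?y x)) (w (?y x)) = ?F x"
        by (simp add: jac_def t_def[abs_def])
    qed
    show "?F (snd d q) = 0" if "q \<in> fst d" "q \<notin> chart_inv c ` cball x0 r" for q
    proof -
      have "?X q = 0"
      proof (cases "q \<in> fst c")
        case True
        then have "snd c q \<notin> cball x0 r"
          using that(2) chart_inv_chart[OF c(1) True] by (metis imageI)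
        then show ?thesis
          using True zero[of "snd c q"] linear_0[OF linear_jac[OF c(1) chart_at_mem(1) True chart_at_mem(2)]]
          by simp
      qed simp
      then show ?thesis
        using that chart_inv_chart[OF d] linear_0[OF linear_components[OF d]] by auto
    qed
  qed
qed

section \<open>Test functions, cut-off frames and extension of tangent vectors\<close>

lemma exists_chart_bump:
  obtains x0 r B where "x0 = snd (chart_at A p) p" "cball x0 r \<subseteq> snd (chart_at A p) ` fst (chart_at A p)"
    "smooth_on UNIV B" "B x0 = (1::real)" "\<And>x. x \<notin> cball x0 r \<Longrightarrow> B x = 0"
proof -
  obtain r where r: "0 < r" "cball (snd (chart_at A p) p) r \<subseteq> snd (chart_at A p) ` fst (chart_at A p)"
    using open_chart(2)[OF chart_at_mem(1)] chart_at_mem(2) open_contains_cball by blast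
  show ?thesis
    by (rule exists_smooth_bump[OF r(1)], rule that[OF refl r(2)])
qed

text \<open>Coordinate functions, cut off by a bump function, are globally smooth, and their
  differentials at \<open>p\<close> read off the components of a vector. This gives the uniqueness
  behind the definite description in \<open>lie_bracket\<close>.\<close>

lemma vector_eqI:
  assumes "\<And>h. smoothf h \<Longrightarrow> differential A h p v = differential A h p w"
  shows "v = w"
proof (rule euclidean_eqI)
  fix b :: 'e assume "b \<in> Basis"
  define c where "c = chart_at A p"
  have c: "c \<in> A" "p \<in> fst c" by (auto simp: c_def chart_at_mem)
  obtain x0 r B where B: "x0 = snd c p" "cball x0 r \<subseteq> snd c ` fst c" "smooth_on UNIV B"
    "B x0 = (1::real)" "\<And>x. x \<notin> cball x0 r \<Longrightarrow> B x = 0"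
    using exists_chart_bump[of p] unfolding c_def by metis
  define u where "u x = B x * ((x + (- x0)) \<bullet> b)" for x
  have op: "open (snd c ` fst c)" using open_chart c by auto
  have id: "smooth_on (snd c ` fst c) (\<lambda>x. (x + (- x0)) \<bullet> b)"
    by (rule smooth_on_inner[OF op smooth_on_add[OF op smooth_on_bounded_linear[OF op
            bounded_linear_ident] smooth_on_const[OF op]] smooth_on_const[OF op]])
  have "smooth_on (snd c ` fst c) u"
    unfolding u_def by (rule smooth_on_mult[OF op smooth_on_subset[OF B(3) subset_UNIV] id])
  then have sm: "smoothf (\<lambda>q. if q \<in> fst c then u (snd c q) else 0)" (is "smoothf ?h")
    by (rule smooth_fun_extend_by_zero[OF c(1) B(2)]) (simp add: u_def B)
  obtain B' where "(B has_derivative B') (at x0)"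
    using smooth_on_has_derivative[OF B(3)] by blast
  moreover have "((\<lambda>x. (x + (- x0)) \<bullet> b) has_derivative (\<lambda>z. z \<bullet> b)) (at x0)"
    by (auto intro!: derivative_eq_intros)
  \<comment> \<open>The linear factor of \<open>u\<close> vanishes at \<open>x0\<close>, which
    removes the derivative of \<open>B\<close>, and \<open>B x0 = 1\<close>.\<close>
  ultimately have "(u has_derivative (\<lambda>z. z \<bullet> b)) (at x0)"
    unfolding u_def using has_derivative_mult[of B B' x0 UNIV] B(4) by fastforce
  then have "((\<lambda>x. ?h (chart_inv c x)) has_derivative (\<lambda>z. z \<bullet> b)) (at x0)"
    by (rule has_derivative_transform_within_open[OF _ op])
      (use B c chart_inv_mem chart_chart_inv in auto)
  then have "differential A ?h p = (\<lambda>z. z \<bullet> b)"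
    using has_derivative_differential[OF sm, of p] has_derivative_unique
    unfolding B(1) c_def by blast
  then show "v \<bullet> b = w \<bullet> b" using assms[OF sm] by simp
qed

text \<open>The substitute for local frames: \<open>E\<close> and \<open>t\<close> are a coordinate frame and its dual, both cut
  off by a bump function, \<open>\<rho>\<close> is the square of the bump function.\<close>

definition cutoff_frame ::
    "('a \<Rightarrow> real) \<Rightarrow> ('e \<Rightarrow> 'a \<Rightarrow> 'e) \<Rightarrow> ('e \<Rightarrow> 'a \<Rightarrow> 'e \<Rightarrow> real) \<Rightarrow> bool" where
  "cutoff_frame \<rho> E t \<longleftrightarrow> smoothf \<rho> \<and>
     (\<forall>b\<in>Basis. field (E b)) \<and>
     (\<forall>b\<in>Basis. \<forall>q. linear (t b q)) \<and>
     (\<forall>b\<in>Basis. \<forall>X. field X \<longrightarrow> smoothf (\<lambda>q. t b q (X q))) \<and>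
     (\<forall>q v. (\<Sum>b\<in>Basis. t b q v *\<^sub>R E b q) = \<rho> q *\<^sub>R v) \<and>
     (\<forall>b\<in>Basis. \<forall>b'\<in>Basis. \<forall>q. t b q (E b' q) = (if b = b' then \<rho> q else 0))"

lemma cutoff_frameD:
  assumes "cutoff_frame \<rho> E t"
  shows "smoothf \<rho>" "b \<in> Basis \<Longrightarrow> field (E b)" "b \<in> Basis \<Longrightarrow> linear (t b q)"
    "b \<in> Basis \<Longrightarrow> field X \<Longrightarrow> smoothf (\<lambda>q. t b q (X q))"
    "(\<Sum>b\<in>Basis. t b q v *\<^sub>R E b q) = \<rho> q *\<^sub>R v"
    "b \<in> Basis \<Longrightarrow> b' \<in> Basis \<Longrightarrow> t b q (E b' q) = (if b = b' then \<rho> q else 0)"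
  using assms unfolding cutoff_frame_def by simp_all

lemma exists_cutoff_frame:
  obtains \<rho> E t where "cutoff_frame \<rho> E t" "\<rho> p = 1"
proof -
  define c where "c = chart_at A p"
  have c: "c \<in> A" "p \<in> fst c" by (auto simp: c_def chart_at_mem)
  obtain x0 r B where B: "x0 = snd c p" "cball x0 r \<subseteq> snd c ` fst c" "smooth_on UNIV B"
    "B x0 = (1::real)" "\<And>x. x \<notin> cball x0 r \<Longrightarrow> B x = 0"
    using exists_chart_bump[of p] unfolding c_def by metis
  have op: "open (snd c ` fst c)" using open_chart c by auto
  have Bc: "smooth_on (snd c ` fst c) B" by (rule smooth_on_subset[OF B(3) subset_UNIV])
  define \<rho> where "\<rho> q = (if q \<in> fst c then B (snd c q) * B (snd c q) else 0)" for q
  define E where "E b q = (if q \<in> fst c then jac c (chart_at A q) q (B (snd c q) *\<^sub>R b) else 0)" for b q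
  define t where "t b q v = (if q \<in> fst c then B (snd c q) * (components A c q v \<bullet> b) else 0)"
    for b q v
  have lj: "linear (jac c (chart_at A q) q)" if "q \<in> fst c" for q
    using linear_jac c that chart_at_mem by auto
  have lc: "linear (components A c q)" if "q \<in> fst c" for q
    using linear_components c that by auto
  show ?thesis
  proof (rule that)
    show "\<rho> p = 1" using B c by (simp add: \<rho>_def)
    show "cutoff_frame \<rho> E t"
      unfolding cutoff_frame_def
    proof (intro conjI ballI allI impI)
      show "smoothf \<rho>"
        unfolding \<rho>_def
        by (rule smooth_fun_extend_by_zero[OF c(1) B(2) smooth_on_mult[OF op Bc Bc]]) (simp add: B)
      show "field (E b)" for b
        unfolding E_def[abs_def]
        by (rule vector_field_extend_by_zero[OF c(1) B(2) smooth_on_scaleR[OF op Bc smooth_on_const[OF op]]])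
          (simp add: B)
      show "linear (t b q)" for b q
        by (rule linearI) (auto simp: t_def linear_add[OF lc] linear_cmul[OF lc] algebra_simps)
      show "smoothf (\<lambda>q. t b q (X q))" if "field X" for b X
      proof -
        have "smoothf (\<lambda>q. if q \<in> fst c then B (snd c q) * (components A c (chart_inv c (snd c q))
            (X (chart_inv c (snd c q))) \<bullet> b) else 0)"
          by (rule smooth_fun_extend_by_zero[OF c(1) B(2) smooth_on_mult[OF op Bc smooth_on_inner[OF op
                    vector_fieldD[OF that c(1)] smooth_on_const[OF op]]]]) (simp add: B)
        then show ?thesis
          by (rule back_subst[where P = smoothf]) (auto simp: t_def chart_inv_chart[OF c(1)])
      qed
      show "(\<Sum>b\<in>Basis. t b q v *\<^sub>R E b q) = \<rho> q *\<^sub>R v" for q v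
      proof (cases "q \<in> fst c")
        case True
        let ?J = "jac c (chart_at A q) q" and ?w = "components A c q v"
        have "(\<Sum>b\<in>Basis. t b q v *\<^sub>R E b q) = (\<Sum>b\<in>Basis. \<rho> q *\<^sub>R ((?w \<bullet> b) *\<^sub>R ?J b))"
          using True by (simp add: t_def E_def \<rho>_def linear_cmul[OF lj] mult.commute mult.left_commute)
        also have "\<dots> = \<rho> q *\<^sub>R ?J ?w"
          by (simp add: linear_eq_sum_Basis[OF lj[OF True], of ?w] scaleR_right.sum)
        also have "?J ?w = v"
          using True c by (simp add: components_eq_jac jac_jac jac_self chart_at_mem)
        finally show ?thesis .
      qed (simp add: t_def \<rho>_def)
      show "t b q (E b' q) = (if b = b' then \<rho> q else 0)" if "b \<in> Basis" "b' \<in> Basis" for b b' q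
        using that c
        by (auto simp: t_def E_def \<rho>_def components_eq_jac jac_jac jac_self chart_at_mem inner_Basis)
    qed
  qed
qed

text \<open>The frame fields with the constant coefficients \<open>t b p v\<close> add up to
  \<rho>(p) v = v at \<open>p\<close>. The choice in \<open>extend_vector\<close> is thereby
  justified.\<close>

lemma exists_vector_field_extending: "\<exists>X. field X \<and> X p = v"
proof -
  obtain \<rho> E t where f: "cutoff_frame \<rho> E t" "\<rho> p = 1" by (rule exists_cutoff_frame)
  have "field (\<lambda>q. \<Sum>b\<in>Basis. t b p v *\<^sub>R E b q)"
    using cutoff_frameD(2)[OF f(1)]
    by (auto intro!: vector_field_sum vector_field_scaleR smooth_fun_const)
  then show ?thesis using f(2) cutoff_frameD(5)[OF f(1), of p v] by (intro exI) auto
qed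

lemma extend_vector: "field (extend_vector A p v)" "extend_vector A p v p = v"
  using someI_ex[OF exists_vector_field_extending[of p v]] unfolding extend_vector_def by auto

subsection \<open>The Lie bracket\<close>

text \<open>Differentiating the coordinate expression of Y(h) yields a term with the derivative of
  the components of Y and a Hessian term. They are kept apart because only the first survives in a
  commutator.\<close>

lemma differential_vf_deriv:
  assumes "smoothf h" "field Y" and p: "c = chart_at A p" "x0 = snd c p"
    and H: "H = (\<lambda>x. h (chart_inv c x))"
    and Y: "Yc = (\<lambda>x. components A c (chart_inv c x) (Y (chart_inv c x)))"
  shows "differential A (der Y h) p v = frechet_derivative H (at x0) (frechet_derivative Yc (at x0) v) +
    frechet_derivative (\<lambda>x. frechet_derivative H (at x) v) (at x0) (Y p)"
proof -
  have c: "c \<in> A" "p \<in> fst c" by (auto simp: p chart_at_mem)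
  have op: "open (snd c ` fst c)" and x0: "x0 \<in> snd c ` fst c" using open_chart c by (auto simp: p)
  have sH: "smooth_on (snd c ` fst c) H" unfolding H by (rule smooth_funD[OF assms(1) c(1)])
  have sY: "smooth_on (snd c ` fst c) Yc" unfolding Y by (rule vector_fieldD[OF assms(2) c(1)])
  let ?H' = "\<lambda>b x. frechet_derivative H (at x) b"
  let ?H'' = "\<lambda>b z. frechet_derivative (?H' b) (at x0) z"
  have dH: "(?H' b has_derivative ?H'' b) (at x0)" for b
    by (rule smooth_on_has_derivative[OF smooth_on_directional[OF sH] x0])
  have dY: "(Yc has_derivative frechet_derivative Yc (at x0)) (at x0)"
    by (rule smooth_on_has_derivative[OF sY x0])
  have lin: "linear (frechet_derivative H (at x))" if "x \<in> snd c ` fst c" for x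
    by (rule has_derivative_linear[OF smooth_on_has_derivative[OF sH that]])
  have "((\<lambda>x. \<Sum>b\<in>Basis. (Yc x \<bullet> b) *\<^sub>R ?H' b x) has_derivative
      (\<lambda>z. \<Sum>b\<in>Basis. (Yc x0 \<bullet> b) *\<^sub>R ?H'' b z + (frechet_derivative Yc (at x0) z \<bullet> b) *\<^sub>R ?H' b x0)) (at x0)"
    by (intro has_derivative_sum has_derivative_scaleR has_derivative_inner_left dH dY)
  then have "((\<lambda>x. der Y h (chart_inv c x)) has_derivative
      (\<lambda>z. \<Sum>b\<in>Basis. (Yc x0 \<bullet> b) *\<^sub>R ?H'' b z + (frechet_derivative Yc (at x0) z \<bullet> b) *\<^sub>R ?H' b x0)) (at x0)"
  proof (rule has_derivative_transform_within_open[OF _ op x0])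
    fix x assume x: "x \<in> snd c ` fst c"
    show "(\<Sum>b\<in>Basis. (Yc x \<bullet> b) *\<^sub>R ?H' b x) = der Y h (chart_inv c x)"
      unfolding vf_deriv_chart[OF assms(1) c(1) x] H[symmetric]
      using linear_eq_sum_Basis[OF lin[OF x], of "Yc x"] by (simp add: Y)
  qed
  then have "differential A (der Y h) p = (\<lambda>z. \<Sum>b\<in>Basis. (Yc x0 \<bullet> b) *\<^sub>R ?H'' b z +
      (frechet_derivative Yc (at x0) z \<bullet> b) *\<^sub>R ?H' b x0)"
    using has_derivative_differential[OF smooth_fun_vf_deriv[OF assms(2,1)], of p] has_derivative_unique
    unfolding p by blast
  then have "differential A (der Y h) p v = (\<Sum>b\<in>Basis. (Yc x0 \<bullet> b) *\<^sub>R ?H'' b v) +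
      (\<Sum>b\<in>Basis. (frechet_derivative Yc (at x0) v \<bullet> b) *\<^sub>R ?H' b x0)"
    by (simp add: sum.distrib)
  also have "(\<Sum>b\<in>Basis. (frechet_derivative Yc (at x0) v \<bullet> b) *\<^sub>R ?H' b x0) =
      frechet_derivative H (at x0) (frechet_derivative Yc (at x0) v)"
    by (rule linear_eq_sum_Basis[OF lin[OF x0], symmetric])
  \<comment> \<open>Symmetry of the Hessian turns the second derivatives around, so that the sum
    over \<open>b\<close> can be contracted to the direction \<open>Yc x0\<close>.\<close>
  also have "(\<Sum>b\<in>Basis. (Yc x0 \<bullet> b) *\<^sub>R ?H'' b v) = (\<Sum>b\<in>Basis. (Yc x0 \<bullet> b) *\<^sub>R ?H'' v b)"
    using symmetric_second_derivative[OF op sH x0] by simp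
  also have "\<dots> = ?H'' v (Yc x0)"
    by (rule linear_eq_sum_Basis[OF has_derivative_linear[OF dH], symmetric])
  also have "Yc x0 = Y p"
    unfolding Y by (simp add: p chart_inv_chart chart_at_mem components_chart_at)
  finally show ?thesis by simp
qed

text \<open>The coordinate bracket DY(X) - DX(Y) satisfies the defining condition because the
  Hessian terms cancel by symmetry; \<open>vector_eqI\<close> makes it the only such vector, so the
  description denotes it.\<close>

lemma vf_deriv_lie_bracket:
  assumes "field X" "field Y" "smoothf h"
  shows "der (lie_bracket A X Y) h p = der X (der Y h) p - der Y (der X h) p"
proof -
  define c where "c = chart_at A p"
  define x0 where "x0 = snd c p"
  have c: "c \<in> A" "p \<in> fst c" by (auto simp: c_def chart_at_mem)
  define comp where "comp Z x = components A c (chart_inv c x) (Z (chart_inv c x))" for Z x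
  define v where "v = frechet_derivative (comp Y) (at x0) (X p) - frechet_derivative (comp X) (at x0) (Y p)"
  have v: "differential A k p v = der X (der Y k) p - der Y (der X k) p" if k: "smoothf k" for k
  proof -
    define H where "H x = k (chart_inv c x)" for x
    have H: "smooth_on (snd c ` fst c) H" unfolding H_def by (rule smooth_funD[OF k c(1)])
    have x0: "x0 \<in> snd c ` fst c" using c by (simp add: x0_def)
    have lin: "linear (frechet_derivative H (at x0))"
      by (rule has_derivative_linear[OF smooth_on_has_derivative[OF H x0]])
    have "differential A k p v = frechet_derivative H (at x0) v"
      using differential_chart[OF k c] by (simp add: c_def components_chart_at H_def[abs_def] x0_def)
    moreover have "der X (der Y k) p = frechet_derivative H (at x0) (frechet_derivative (comp Y) (at x0) (X p)) +
        frechet_derivative (\<lambda>x. frechet_derivative H (at x) (X p)) (at x0) (Y p)"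
      unfolding vf_deriv_def[of A X]
      by (rule differential_vf_deriv[OF k assms(2) c_def x0_def]) (auto simp: H_def comp_def)
    moreover have "der Y (der X k) p = frechet_derivative H (at x0) (frechet_derivative (comp X) (at x0) (Y p)) +
        frechet_derivative (\<lambda>x. frechet_derivative H (at x) (Y p)) (at x0) (X p)"
      unfolding vf_deriv_def[of A Y]
      by (rule differential_vf_deriv[OF k assms(1) c_def x0_def]) (auto simp: H_def comp_def)
    moreover have "frechet_derivative (\<lambda>x. frechet_derivative H (at x) (Y p)) (at x0) (X p) =
        frechet_derivative (\<lambda>x. frechet_derivative H (at x) (X p)) (at x0) (Y p)"
      by (rule symmetric_second_derivative[OF open_chart(2)[OF c(1)] H x0])
    ultimately show ?thesis by (simp add: v_def linear_diff[OF lin])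
  qed
  have "lie_bracket A X Y p = v"
    unfolding lie_bracket_def
  proof (rule the_equality)
    fix w
    assume "\<forall>h. smoothf h \<longrightarrow> differential A h p w = der X (der Y h) p - der Y (der X h) p"
    then show "w = v" using v by (intro vector_eqI[of p]) auto
  qed (use v in blast)
  then show ?thesis using v[OF assms(3)] by (simp add: vf_deriv_def)
qed

lemma field_eqI:
  assumes "\<And>h p. smoothf h \<Longrightarrow> der X h p = der Y h p"
  shows "X = Y"
  using assms by (intro ext vector_eqI) (simp add: vf_deriv_def)

subsection \<open>Traces of tensorial operators\<close>

text \<open>\<open>C\<^sup>\<infinity>\<close>-linear operators on vector fields, with values in an arbitrary real vector space so that
  one-forms are included.\<close>

definition tensorial :: "(('a \<Rightarrow> 'e) \<Rightarrow> 'a \<Rightarrow> 'b::real_vector) \<Rightarrow> bool" where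
  "tensorial L \<longleftrightarrow>
     (\<forall>X Y. field X \<longrightarrow> field Y \<longrightarrow> L (\<lambda>p. X p + Y p) = (\<lambda>p. L X p + L Y p)) \<and>
     (\<forall>h X. smoothf h \<longrightarrow> field X \<longrightarrow> L (\<lambda>p. h p *\<^sub>R X p) = (\<lambda>p. h p *\<^sub>R L X p))"

text \<open>Has the same shape as \<open>ricci\<close>, so that the Ricci tensor is such a trace by
  unfolding alone.\<close>

definition trace :: "(('a \<Rightarrow> 'e) \<Rightarrow> 'a \<Rightarrow> 'e) \<Rightarrow> 'a \<Rightarrow> real" where
  "trace L p = (\<Sum>b\<in>Basis. L (extend_vector A p b) p \<bullet> b)"

lemma tensorialI:
  assumes "\<And>X Y p. field X \<Longrightarrow> field Y \<Longrightarrow> L (\<lambda>p. X p + Y p) p = L X p + L Y p"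
    and "\<And>h X p. smoothf h \<Longrightarrow> field X \<Longrightarrow> L (\<lambda>p. h p *\<^sub>R X p) p = h p *\<^sub>R L X p"
  shows "tensorial L"
  unfolding tensorial_def using assms by auto

lemma tensorial_add:
  "tensorial L \<Longrightarrow> field X \<Longrightarrow> field Y \<Longrightarrow> L (\<lambda>p. X p + Y p) = (\<lambda>p. L X p + L Y p)"
  by (simp add: tensorial_def)

lemma tensorial_scaleR:
  "tensorial L \<Longrightarrow> smoothf h \<Longrightarrow> field X \<Longrightarrow> L (\<lambda>p. h p *\<^sub>R X p) = (\<lambda>p. h p *\<^sub>R L X p)"
  by (simp add: tensorial_def)

lemma tensorial_minus: "tensorial L \<Longrightarrow> field X \<Longrightarrow> L (\<lambda>p. - X p) = (\<lambda>p. - L X p)"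
  using tensorial_scaleR[OF _ smooth_fun_const, of L X "-1"] by simp

lemma tensorial_diff:
  assumes "tensorial L" "field X" "field Y"
  shows "L (\<lambda>p. X p - Y p) = (\<lambda>p. L X p - L Y p)"
  using tensorial_add[OF assms(1,2) vector_field_minus[OF assms(3)]] tensorial_minus[OF assms(1,3)]
  by simp

lemma tensorial_zero: "tensorial L \<Longrightarrow> L (\<lambda>p. 0) = (\<lambda>p. 0)"
  using tensorial_scaleR[OF _ smooth_fun_const vector_field_zero, of L 0] by simp

lemma tensorial_sum:
  assumes "tensorial L" "finite I" "\<And>i. i \<in> I \<Longrightarrow> field (X i)"
  shows "L (\<lambda>p. \<Sum>i\<in>I. X i p) = (\<lambda>p. \<Sum>i\<in>I. L (X i) p)"
  using assms(2,3)
proof (induction I rule: finite_induct)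
  case empty
  then show ?case by (simp add: tensorial_zero[OF assms(1)])
next
  case (insert i I)
  then show ?case using tensorial_add[OF assms(1), of "X i" "\<lambda>p. \<Sum>i\<in>I. X i p"]
    by (simp add: vector_field_sum)
qed

text \<open>The multiple \<rho> X, unlike X itself, has a global expansion in the fields
  \<open>E b\<close>, and \<open>L\<close> can be applied to it term by term.\<close>

lemma tensorial_cutoff_frame:
  assumes L: "tensorial L" and X: "field X" and f: "cutoff_frame \<rho> E t"
  shows "\<rho> q *\<^sub>R L X q = (\<Sum>b\<in>Basis. t b q (X q) *\<^sub>R L (E b) q)"
proof -
  have "L (\<lambda>q. \<rho> q *\<^sub>R X q) q = L (\<lambda>q. \<Sum>b\<in>Basis. t b q (X q) *\<^sub>R E b q) q"
    by (simp add: cutoff_frameD(5)[OF f])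
  also have "\<dots> = (\<Sum>b\<in>Basis. t b q (X q) *\<^sub>R L (E b) q)"
    using X cutoff_frameD(2,4)[OF f] by (simp add: tensorial_sum[OF L] tensorial_scaleR[OF L] vector_field_scaleR)
  finally show ?thesis using X cutoff_frameD(1)[OF f] by (simp add: tensorial_scaleR[OF L])
qed

text \<open>At \<open>p\<close>, where \<rho> = 1, the frame expansion involves the argument only
  through its value at \<open>p\<close>.\<close>

lemma tensorial_pointwise:
  assumes "tensorial L" "field X" "field Y" "X p = Y p"
  shows "L X p = L Y p"
proof -
  obtain \<rho> E t where f: "cutoff_frame \<rho> E t" "\<rho> p = 1" by (rule exists_cutoff_frame)
  show ?thesis
    using tensorial_cutoff_frame[OF assms(1,2) f(1), of p]
      tensorial_cutoff_frame[OF assms(1,3) f(1), of p] assms(4) f(2) by simp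
qed

lemma tensorial_expand:
  assumes L: "tensorial L" and X: "field X"
  shows "L X p = (\<Sum>b\<in>Basis. (X p \<bullet> b) *\<^sub>R L (extend_vector A p b) p)"
proof -
  let ?Y = "\<lambda>q. \<Sum>b\<in>Basis. (X p \<bullet> b) *\<^sub>R extend_vector A p b q"
  have "field ?Y"
    by (intro vector_field_sum vector_field_scaleR smooth_fun_const extend_vector finite_Basis)
  moreover have "X p = ?Y p" by (simp add: extend_vector euclidean_representation)
  ultimately have "L X p = L ?Y p" by (rule tensorial_pointwise[OF L X])
  then show ?thesis
    by (simp add: tensorial_sum[OF L] tensorial_scaleR[OF L] vector_field_scaleR smooth_fun_const
        extend_vector)
qed

lemma trace_cong: "(\<And>X. field X \<Longrightarrow> L X p = K X p) \<Longrightarrow> trace L p = trace K p"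
  by (simp add: trace_def extend_vector)

lemma trace_add: "trace (\<lambda>X p. L X p + K X p) p = trace L p + trace K p"
  by (simp add: trace_def inner_add_left sum.distrib)

lemma trace_diff: "trace (\<lambda>X p. L X p - K X p) p = trace L p - trace K p"
  by (simp add: trace_def inner_diff_left sum_subtractf)

lemma trace_scaleR: "trace (\<lambda>X p. h p *\<^sub>R L X p) p = h p * trace L p"
  by (simp add: trace_def sum_distrib_left)

lemma trace_zero: "trace (\<lambda>X p. 0) p = 0"
  by (simp add: trace_def)

lemma trace_id: "trace (\<lambda>X p. X p) p = DIM('e)"
  by (simp add: trace_def extend_vector inner_Basis)

lemma trace_rank_one:
  fixes \<omega> :: "('a \<Rightarrow> 'e) \<Rightarrow> 'a \<Rightarrow> real"
  assumes "tensorial \<omega>" "field U"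
  shows "trace (\<lambda>X p. \<omega> X p *\<^sub>R U p) p = \<omega> U p"
  using tensorial_expand[OF assms, of p] by (simp add: trace_def mult.commute)

text \<open>Both traces are the same double sum of products of matrix coefficients.\<close>

lemma trace_commute:
  assumes K: "tensorial K" "\<And>X. field X \<Longrightarrow> field (K X)"
    and L: "tensorial L" "\<And>X. field X \<Longrightarrow> field (L X)"
  shows "trace (\<lambda>X. K (L X)) p = trace (\<lambda>X. L (K X)) p"
proof -
  let ?e = "extend_vector A p"
  have "trace (\<lambda>X. K (L X)) p = (\<Sum>b\<in>Basis. \<Sum>c\<in>Basis. (L (?e b) p \<bullet> c) * (K (?e c) p \<bullet> b))"
    using tensorial_expand[OF K(1) L(2)] by (simp add: trace_def extend_vector inner_sum_left)
  also have "\<dots> = (\<Sum>c\<in>Basis. \<Sum>b\<in>Basis. (K (?e c) p \<bullet> b) * (L (?e b) p \<bullet> c))"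
    by (subst sum.swap) (simp add: mult.commute)
  also have "\<dots> = trace (\<lambda>X. L (K X)) p"
    using tensorial_expand[OF L(1) K(2)] by (simp add: trace_def extend_vector inner_sum_left)
  finally show ?thesis .
qed

text \<open>The vectors \<open>extend_vector A q b\<close> vary with \<open>q\<close> in an
  uncontrolled way. Here they are replaced by fields fixed for all \<open>q\<close>, so that a trace
  can be tested for smoothness and differentiated.\<close>

lemma trace_cutoff_frame:
  assumes L: "tensorial L" "\<And>X. field X \<Longrightarrow> field (L X)" and f: "cutoff_frame \<rho> E t"
  shows "\<rho> q * trace L q = (\<Sum>b\<in>Basis. t b q (L (E b) q))"
proof -
  have "\<rho> q * (L (extend_vector A q c) q \<bullet> c) = (\<Sum>b\<in>Basis. t b q c * (L (E b) q \<bullet> c))" for c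
  proof -
    have "\<rho> q *\<^sub>R L (extend_vector A q c) q = (\<Sum>b\<in>Basis. t b q c *\<^sub>R L (E b) q)"
      using tensorial_cutoff_frame[OF L(1) extend_vector(1)[of q c] f, of q]
      by (simp add: extend_vector)
    then have "(\<rho> q *\<^sub>R L (extend_vector A q c) q) \<bullet> c = (\<Sum>b\<in>Basis. t b q c *\<^sub>R L (E b) q) \<bullet> c"
      by simp
    then show ?thesis by (simp add: inner_sum_left)
  qed
  then have "\<rho> q * trace L q = (\<Sum>c\<in>Basis. \<Sum>b\<in>Basis. t b q c * (L (E b) q \<bullet> c))"
    by (simp add: trace_def sum_distrib_left)
  also have "\<dots> = (\<Sum>b\<in>Basis. \<Sum>c\<in>Basis. (L (E b) q \<bullet> c) * t b q c)"
    by (subst sum.swap) (simp add: mult.commute)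
  also have "\<dots> = (\<Sum>b\<in>Basis. t b q (L (E b) q))"
  proof (rule sum.cong[OF refl])
    fix b :: 'e assume "b \<in> Basis"
    from linear_eq_sum_Basis[OF cutoff_frameD(3)[OF f this, of q], of "L (E b) q"]
    show "(\<Sum>c\<in>Basis. (L (E b) q \<bullet> c) * t b q c) = t b q (L (E b) q)" by simp
  qed
  finally show ?thesis .
qed

lemma smooth_fun_trace:
  assumes "tensorial L" "\<And>X. field X \<Longrightarrow> field (L X)"
  shows "smoothf (trace L)"
proof (rule smooth_fun_if_multiple)
  fix p
  obtain \<rho> E t where f: "cutoff_frame \<rho> E t" "\<rho> p = 1" by (rule exists_cutoff_frame)
  have "smoothf (\<lambda>q. \<Sum>b\<in>Basis. t b q (L (E b) q))"
    using cutoff_frameD(2,4)[OF f(1)] assms(2) by (auto intro!: smooth_fun_sum)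
  then have "smoothf (\<lambda>q. \<rho> q * trace L q)"
    using trace_cutoff_frame[OF assms f(1)] by simp
  then show "\<exists>\<rho>. smoothf \<rho> \<and> \<rho> p \<noteq> 0 \<and> smoothf (\<lambda>q. \<rho> q * trace L q)"
    using f(2) cutoff_frameD(1)[OF f(1)] by (intro exI[of _ \<rho>]) simp
qed

section \<open>Tensor fields of type (0,2) acting on vector fields\<close>

definition tensor2 :: "('a, 'e) tensor02 \<Rightarrow> bool" where
  "tensor2 T \<longleftrightarrow> (\<forall>X Y. field X \<longrightarrow> field Y \<longrightarrow> smoothf (T X Y)) \<and>
     (\<forall>Y. field Y \<longrightarrow> tensorial (\<lambda>X. T X Y)) \<and> (\<forall>X. field X \<longrightarrow> tensorial (T X))"

lemma tensor2D:
  assumes "tensor2 T" "field X"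
  shows "field Y \<Longrightarrow> smoothf (T X Y)" "tensorial (\<lambda>Y. T Y X)" "tensorial (T X)"
  using assms by (auto simp: tensor2_def)

lemma tensor2_add_scaled:
  assumes "tensor2 T" "tensor2 S"
  shows "tensor2 (\<lambda>X Y p. T X Y p + a * S X Y p)"
  unfolding tensor2_def
proof (intro conjI allI impI tensorialI)
  fix X Y assume f: "field X" "field Y"
  then show "smoothf (\<lambda>p. T X Y p + a * S X Y p)"
    using assms by (intro smooth_fun_add smooth_fun_mult smooth_fun_const) (auto simp: tensor2D)
next
  fix X Y Z p assume f: "field X" "field Y" "field Z"
  then show "T (\<lambda>p. X p + Y p) Z p + a * S (\<lambda>p. X p + Y p) Z p =
      T X Z p + a * S X Z p + (T Y Z p + a * S Y Z p)"
    using tensorial_add[OF tensor2D(2)[OF assms(1)], of Z X Y]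
      tensorial_add[OF tensor2D(2)[OF assms(2)], of Z X Y] by (simp add: algebra_simps)
  from f show "T Z (\<lambda>p. X p + Y p) p + a * S Z (\<lambda>p. X p + Y p) p =
      T Z X p + a * S Z X p + (T Z Y p + a * S Z Y p)"
    using tensorial_add[OF tensor2D(3)[OF assms(1)], of Z X Y]
      tensorial_add[OF tensor2D(3)[OF assms(2)], of Z X Y] by (simp add: algebra_simps)
next
  fix h X Z p assume f: "smoothf h" "field X" "field Z"
  then show "T (\<lambda>p. h p *\<^sub>R X p) Z p + a * S (\<lambda>p. h p *\<^sub>R X p) Z p =
      h p *\<^sub>R (T X Z p + a * S X Z p)"
    using tensorial_scaleR[OF tensor2D(2)[OF assms(1)], of Z h X]
      tensorial_scaleR[OF tensor2D(2)[OF assms(2)], of Z h X] by (simp add: algebra_simps)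
  from f show "T Z (\<lambda>p. h p *\<^sub>R X p) p + a * S Z (\<lambda>p. h p *\<^sub>R X p) p =
      h p *\<^sub>R (T Z X p + a * S Z X p)"
    using tensorial_scaleR[OF tensor2D(3)[OF assms(1)], of Z h X]
      tensorial_scaleR[OF tensor2D(3)[OF assms(2)], of Z h X] by (simp add: algebra_simps)
qed

end

section \<open>Riemannian manifolds\<close>

locale riemannian_manifold = smooth_manifold A
  for A :: "('a::t2_space, 'e::euclidean_space) chart set" +
  fixes g :: "'a \<Rightarrow> 'e \<Rightarrow> 'e \<Rightarrow> real" and nabla :: "('a, 'e) connection"
  assumes metric: "riemannian_metric A g" and levi_civita: "levi_civita A g nabla"
begin

abbreviation bracket :: "('a \<Rightarrow> 'e) \<Rightarrow> ('a \<Rightarrow> 'e) \<Rightarrow> 'a \<Rightarrow> 'e" where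
  "bracket \<equiv> lie_bracket A"

abbreviation R :: "('a \<Rightarrow> 'e) \<Rightarrow> ('a \<Rightarrow> 'e) \<Rightarrow> ('a \<Rightarrow> 'e) \<Rightarrow> 'a \<Rightarrow> 'e" where
  "R \<equiv> curvature A nabla"

lemmas [simp] = smooth_fun_const smooth_fun_add smooth_fun_mult smooth_fun_minus smooth_fun_diff
  smooth_fun_power2 vector_field_add vector_field_scaleR vector_field_minus vector_field_diff
  vector_field_zero smooth_fun_vf_deriv

lemma connection: "affine_connection A nabla"
  using levi_civita by (simp add: levi_civita_def)

lemma vector_field_nabla [simp]: "field X \<Longrightarrow> field Y \<Longrightarrow> field (nabla X Y)"
  using connection by (simp add: affine_connection_def)

lemma nabla_add_left: "field X \<Longrightarrow> field X' \<Longrightarrow> field Y \<Longrightarrow>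
    nabla (\<lambda>p. X p + X' p) Y = (\<lambda>p. nabla X Y p + nabla X' Y p)"
  using connection by (simp add: affine_connection_def)

lemma nabla_scaleR_left: "smoothf h \<Longrightarrow> field X \<Longrightarrow> field Y \<Longrightarrow>
    nabla (\<lambda>p. h p *\<^sub>R X p) Y = (\<lambda>p. h p *\<^sub>R nabla X Y p)"
  using connection by (simp add: affine_connection_def)

lemma nabla_add: "field X \<Longrightarrow> field Y \<Longrightarrow> field Y' \<Longrightarrow>
    nabla X (\<lambda>p. Y p + Y' p) = (\<lambda>p. nabla X Y p + nabla X Y' p)"
  using connection by (simp add: affine_connection_def)

lemma nabla_scaleR: "smoothf h \<Longrightarrow> field X \<Longrightarrow> field Y \<Longrightarrow>
    nabla X (\<lambda>p. h p *\<^sub>R Y p) = (\<lambda>p. der X h p *\<^sub>R Y p + h p *\<^sub>R nabla X Y p)"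
  using connection by (simp add: affine_connection_def)

lemma tensorial_nabla: "field Y \<Longrightarrow> tensorial (\<lambda>X. nabla X Y)"
  by (rule tensorialI) (simp_all add: nabla_add_left nabla_scaleR_left)

lemmas nabla_diff_left = tensorial_diff[OF tensorial_nabla]
lemmas nabla_minus_left = tensorial_minus[OF tensorial_nabla]
lemmas nabla_zero_left = tensorial_zero[OF tensorial_nabla]

lemma nabla_minus: "field X \<Longrightarrow> field Y \<Longrightarrow> nabla X (\<lambda>p. - Y p) = (\<lambda>p. - nabla X Y p)"
  using nabla_scaleR[OF smooth_fun_const, of X Y "-1"] by (simp add: vf_deriv_const)

lemma nabla_zero: "field X \<Longrightarrow> nabla X (\<lambda>p. 0) = (\<lambda>p. 0)"
  using nabla_scaleR[OF smooth_fun_const _ vector_field_zero, of X 0] by (simp add: vf_deriv_const)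

lemma nabla_diff: "field X \<Longrightarrow> field Y \<Longrightarrow> field Y' \<Longrightarrow>
    nabla X (\<lambda>p. Y p - Y' p) = (\<lambda>p. nabla X Y p - nabla X Y' p)"
  using nabla_add[of X Y "\<lambda>p. - Y' p"] by (simp add: nabla_minus)

lemma nabla_sum:
  assumes "field X" "finite I" "\<And>i. i \<in> I \<Longrightarrow> field (Y i)"
  shows "nabla X (\<lambda>p. \<Sum>i\<in>I. Y i p) = (\<lambda>p. \<Sum>i\<in>I. nabla X (Y i) p)"
  using assms(2,3)
proof (induction I rule: finite_induct)
  case (insert i I)
  then show ?case using assms(1) by (simp add: nabla_add vector_field_sum)
qed (simp add: nabla_zero assms(1))

lemma bracket_eq: "field X \<Longrightarrow> field Y \<Longrightarrow> bracket X Y = (\<lambda>p. nabla X Y p - nabla Y X p)"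
  using levi_civita by (simp add: levi_civita_def fun_eq_iff)

lemma vector_field_bracket [simp]: "field X \<Longrightarrow> field Y \<Longrightarrow> field (bracket X Y)"
  by (simp add: bracket_eq)

text \<open>Brackets act on functions as commutators of derivations, where the identity is formal
  cancellation, and a field is determined by its action on functions.\<close>

lemma jacobi:
  assumes "field X" "field Y" "field Z"
  shows "bracket X (bracket Y Z) p + bracket Y (bracket Z X) p + bracket Z (bracket X Y) p = 0"
proof -
  have "(\<lambda>p. bracket X (bracket Y Z) p + bracket Y (bracket Z X) p + bracket Z (bracket X Y) p) =
      (\<lambda>p. 0)"
  proof (rule field_eqI)
    fix h p assume h: "smoothf h"
    have b: "der (bracket U W) k = (\<lambda>p. der U (der W k) p - der W (der U k) p)"
      if "field U" "field W" "smoothf k" for U W k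
      using vf_deriv_lie_bracket[OF that] by auto
    show "der (\<lambda>p. bracket X (bracket Y Z) p + bracket Y (bracket Z X) p + bracket Z (bracket X Y) p) h p
      = der (\<lambda>p. 0) h p"
      using assms h by (simp add: vf_deriv_field_add b vf_deriv_diff linear_0[OF linear_differential]
          vf_deriv_def[of A "\<lambda>p. 0"])
  qed
  then show ?thesis by (rule fun_cong)
qed

subsection \<open>The metric\<close>

lemma metric_sym: "g p u v = g p v u"
  using metric by (simp add: riemannian_metric_def)

lemma smooth_fun_metric [simp]: "field X \<Longrightarrow> field Y \<Longrightarrow> smoothf (\<lambda>p. g p (X p) (Y p))"
  using metric by (simp add: riemannian_metric_def)

lemma metric_bilinear: "bilinear (g p)"
  using metric by (simp add: riemannian_metric_def)

lemmas metric_simps =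
  bilinear_ladd[OF metric_bilinear] bilinear_radd[OF metric_bilinear]
  bilinear_lsub[OF metric_bilinear] bilinear_rsub[OF metric_bilinear]
  bilinear_lmul[OF metric_bilinear] bilinear_rmul[OF metric_bilinear]
  bilinear_lneg[OF metric_bilinear] bilinear_rneg[OF metric_bilinear]
  bilinear_lzero[OF metric_bilinear] bilinear_rzero[OF metric_bilinear]

lemma metric_eqI:
  assumes "\<And>w. g p u w = g p v w"
  shows "u = v"
proof (rule ccontr)
  assume "u \<noteq> v"
  then have "0 < g p (u - v) (u - v)" using metric by (simp add: riemannian_metric_def)
  then show False using assms by (simp add: metric_simps)
qed

lemma tensor2_metric: "tensor2 (as_tensor02 g)"
  unfolding tensor2_def as_tensor02_def
  by (auto intro!: tensorialI simp: metric_simps algebra_simps)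

lemma vf_deriv_metric:
  assumes "field X" "field Y" "field Z"
  shows "der X (\<lambda>p. g p (Y p) (Z p)) p = g p (nabla X Y p) (Z p) + g p (Y p) (nabla X Z p)"
proof -
  have "der X (as_tensor02 g Y Z) p - as_tensor02 g (nabla X Y) Z p - as_tensor02 g Y (nabla X Z) p = 0"
    using levi_civita assms by (simp add: levi_civita_def parallel_def)
  then show ?thesis by (simp add: as_tensor02_def)
qed

text \<open>Metric compatibility expands V(g(X, Y)), torsion-freeness rewrites the brackets, and the
  derivatives of X and Y along V cancel. Tensoriality is visible on the resulting form.\<close>

lemma lie_derivative_metric:
  assumes "field V" "field X" "field Y"
  shows "lie_derivative A V (as_tensor02 g) X Y p = g p (nabla X V p) (Y p) + g p (X p) (nabla Y V p)"
  using assms by (simp add: lie_derivative_def as_tensor02_def vf_deriv_metric bracket_eq metric_simps)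

lemma tensor2_lie_derivative:
  assumes "field V"
  shows "tensor2 (lie_derivative A V (as_tensor02 g))"
  unfolding tensor2_def
proof (intro conjI allI impI tensorialI)
  fix X Y assume "field X" "field Y"
  then have "lie_derivative A V (as_tensor02 g) X Y = (\<lambda>p. g p (nabla X V p) (Y p) + g p (X p) (nabla Y V p))"
    using assms lie_derivative_metric by auto
  then show "smoothf (lie_derivative A V (as_tensor02 g) X Y)"
    using \<open>field X\<close> \<open>field Y\<close> assms by simp
qed (use assms in \<open>simp_all add: lie_derivative_metric nabla_add_left nabla_scaleR_left metric_simps
    algebra_simps\<close>)

subsection \<open>Curvature\<close>

lemma vector_field_curvature [simp]: "field X \<Longrightarrow> field Y \<Longrightarrow> field Z \<Longrightarrow> field (R X Y Z)"
  unfolding curvature_def by simp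

lemma curvature_antisym:
  assumes "field X" "field Y" "field Z"
  shows "R X Y Z p = - R Y X Z p"
  using assms by (simp add: curvature_def bracket_eq nabla_diff_left)

lemma tensorial_curvature1:
  assumes "field Y" "field Z"
  shows "tensorial (\<lambda>X. R X Y Z)"
proof (rule tensorialI)
  fix X X' p assume "field X" "field X'"
  then show "R (\<lambda>p. X p + X' p) Y Z p = R X Y Z p + R X' Y Z p"
    using assms by (simp add: curvature_def bracket_eq nabla_add_left nabla_add nabla_diff_left)
next
  fix h X p assume "smoothf h" "field X"
  then show "R (\<lambda>p. h p *\<^sub>R X p) Y Z p = h p *\<^sub>R R X Y Z p"
    using assms by (simp add: curvature_def bracket_eq nabla_scaleR_left nabla_scaleR nabla_diff_left
        nabla_add_left algebra_simps)
qed

lemma tensorial_curvature2: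
  assumes "field X" "field Z"
  shows "tensorial (\<lambda>Y. R X Y Z)"
proof (rule tensorialI)
  fix Y Y' p assume "field Y" "field Y'"
  then show "R X (\<lambda>p. Y p + Y' p) Z p = R X Y Z p + R X Y' Z p"
    using assms tensorial_add[OF tensorial_curvature1, of X Z Y Y'] by (simp add: curvature_antisym[of X])
next
  fix h Y p assume "smoothf h" "field Y"
  then show "R X (\<lambda>p. h p *\<^sub>R Y p) Z p = h p *\<^sub>R R X Y Z p"
    using assms tensorial_scaleR[OF tensorial_curvature1, of X Z h Y] by (simp add: curvature_antisym[of X])
qed

lemma tensorial_curvature3:
  assumes "field X" "field Y"
  shows "tensorial (\<lambda>Z. R X Y Z)"
proof (rule tensorialI)
  fix Z Z' p assume "field Z" "field Z'"
  then show "R X Y (\<lambda>p. Z p + Z' p) p = R X Y Z p + R X Y Z' p"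
    using assms by (simp add: curvature_def nabla_add)
next
  fix h Z p assume "smoothf h" "field Z"
  then show "R X Y (\<lambda>p. h p *\<^sub>R Z p) p = h p *\<^sub>R R X Y Z p"
    \<comment> \<open>The second derivatives of \<open>h\<close> cancel because the bracket
      differentiates \<open>h\<close> as the commutator of X and Y.\<close>
    using assms by (simp add: curvature_def nabla_scaleR nabla_add vf_deriv_lie_bracket algebra_simps)
qed

text \<open>Written with torsion-free brackets, the Jacobi sum is the cyclic sum of
  curvatures.\<close>

lemma bianchi1:
  assumes "field X" "field Y" "field Z"
  shows "R X Y Z p + R Y Z X p + R Z X Y p = 0"
proof -
  have b: "bracket U (bracket V W) p = nabla U (nabla V W) p - nabla U (nabla W V) p - nabla (bracket V W) U p"
    if "field U" "field V" "field W" for U V W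
    using that bracket_eq[of U "bracket V W"] bracket_eq[of V W] by (simp add: nabla_diff)
  show ?thesis
    using jacobi[OF assms, of p] assms by (simp add: b curvature_def algebra_simps)
qed

text \<open>The covariant derivative (\<nabla>R)(Y, Z)W in the direction X, the direction being the
  first argument.\<close>

definition nabla_curvature ::
    "('a \<Rightarrow> 'e) \<Rightarrow> ('a \<Rightarrow> 'e) \<Rightarrow> ('a \<Rightarrow> 'e) \<Rightarrow> ('a \<Rightarrow> 'e) \<Rightarrow> 'a \<Rightarrow> 'e" where
  "nabla_curvature X Y Z W p =
     nabla X (R Y Z W) p - R (nabla X Y) Z W p - R Y (nabla X Z) W p - R Y Z (nabla X W) p"

text \<open>All terms expand into iterated covariant derivatives of W. In the cyclic sum the
  third-order ones cancel and what remains is the derivative of W along a Jacobi sum, which is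
  zero.\<close>

lemma bianchi2:
  assumes f: "field X" "field Y" "field Z" "field W"
  shows "nabla_curvature X Y Z W p + nabla_curvature Y Z X W p + nabla_curvature Z X Y W p = 0"
proof -
  have 1: "nabla X (R Y Z W) p - R Y Z (nabla X W) p =
      nabla X (nabla Y (nabla Z W)) p - nabla X (nabla Z (nabla Y W)) p - nabla X (nabla (bracket Y Z) W) p
      - (nabla Y (nabla Z (nabla X W)) p - nabla Z (nabla Y (nabla X W)) p - nabla (bracket Y Z) (nabla X W) p)"
    if "field X" "field Y" "field Z" for X Y Z
    using that f(4) by (simp add: curvature_def nabla_diff)
  \<comment> \<open>The correction terms of the cyclic sum pair up in this way, and torsion-freeness
    makes each pair a curvature in the bracket.\<close>
  have 2: "R (nabla X Y) Z W p - R (nabla Y X) Z W p =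
      nabla (bracket X Y) (nabla Z W) p - nabla Z (nabla (bracket X Y) W) p + nabla (bracket Z (bracket X Y)) W p"
    if "field X" "field Y" "field Z" for X Y Z
  proof -
    have "R (nabla X Y) Z W p - R (nabla Y X) Z W p = R (bracket X Y) Z W p"
      using that f(4) tensorial_diff[OF tensorial_curvature1, of Z W "nabla X Y" "nabla Y X"]
      by (simp add: bracket_eq)
    moreover have "bracket (bracket X Y) Z = (\<lambda>p. - bracket Z (bracket X Y) p)"
      using that bracket_eq[of "bracket X Y" Z] bracket_eq[of Z "bracket X Y"] by simp
    ultimately show ?thesis using that f(4) by (simp add: curvature_def nabla_minus_left)
  qed
  have 3: "R Y (nabla X Z) W p = - R (nabla X Z) Y W p" if "field X" "field Y" "field Z" for X Y Z
    using that f(4) by (simp add: curvature_antisym[of Y])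
  have "(\<lambda>p. bracket X (bracket Y Z) p + bracket Y (bracket Z X) p + bracket Z (bracket X Y) p) = (\<lambda>p. 0)"
    using jacobi f by simp
  then have "nabla (\<lambda>p. bracket X (bracket Y Z) p + bracket Y (bracket Z X) p + bracket Z (bracket X Y) p) W p = 0"
    using nabla_zero_left[OF f(4)] by simp
  then have 4: "nabla (bracket X (bracket Y Z)) W p + nabla (bracket Y (bracket Z X)) W p +
      nabla (bracket Z (bracket X Y)) W p = 0"
    using f by (simp add: nabla_add_left)
  have "nabla_curvature X Y Z W p + nabla_curvature Y Z X W p + nabla_curvature Z X Y W p =
      (nabla X (R Y Z W) p - R Y Z (nabla X W) p) + (nabla Y (R Z X W) p - R Z X (nabla Y W) p) +
      (nabla Z (R X Y W) p - R X Y (nabla Z W) p)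
      - (R (nabla X Y) Z W p - R (nabla Y X) Z W p) - (R (nabla Y Z) X W p - R (nabla Z Y) X W p)
      - (R (nabla Z X) Y W p - R (nabla X Z) Y W p)"
    unfolding nabla_curvature_def using f by (simp add: 3 algebra_simps)
  also have "\<dots> = - (nabla (bracket X (bracket Y Z)) W p + nabla (bracket Y (bracket Z X)) W p +
      nabla (bracket Z (bracket X Y)) W p)"
    using f by (simp add: 1 2 algebra_simps)
  finally show ?thesis by (simp add: 4)
qed

text \<open>The bracket of X and Y acts on the function T(Z, W) as a commutator. Parallelism moves
  all derivatives onto Z and W; the mixed terms cancel and the rest assembles to the
  curvature.\<close>

lemma parallel_imp_curvature_annihilates:
  assumes T: "tensor2 T" "parallel A nabla T" and f: "field X" "field Y" "field Z" "field W"
  shows "T (R X Y Z) W p + T Z (R X Y W) p = 0"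
proof -
  have par: "der U (T P Q) = (\<lambda>p. T (nabla U P) Q p + T P (nabla U Q) p)"
    if "field U" "field P" "field Q" for U P Q
    using T(2) that by (auto simp: parallel_def fun_eq_iff algebra_simps)
  have d: "T (\<lambda>p. P p - P' p) Q = (\<lambda>p. T P Q p - T P' Q p)"
    "T Q (\<lambda>p. P p - P' p) = (\<lambda>p. T Q P p - T Q P' p)" if "field P" "field P'" "field Q" for P P' Q
    using tensorial_diff[OF tensor2D(2)[OF T(1)]] tensorial_diff[OF tensor2D(3)[OF T(1)]] that by auto
  have "der (bracket X Y) (T Z W) p = der X (der Y (T Z W)) p - der Y (der X (T Z W)) p"
    using vf_deriv_lie_bracket[OF f(1,2) tensor2D(1)[OF T(1) f(3,4)]] .
  then show ?thesis
    using f T(1) by (simp add: par curvature_def d vf_deriv_add tensor2D)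
qed

lemma curvature_skew:
  assumes "field X" "field Y" "field Z" "field W"
  shows "g p (R X Y Z p) (W p) = - g p (Z p) (R X Y W p)"
proof -
  have "parallel A nabla (as_tensor02 g)" using levi_civita by (simp add: levi_civita_def)
  from parallel_imp_curvature_annihilates[OF tensor2_metric this assms]
  show ?thesis unfolding as_tensor02_def by (metis eq_neg_iff_add_eq_0)
qed

text \<open>The classical octahedron argument: the first Bianchi identity for the four cyclic shifts
  of (X, Y, Z, W), combined linearly with the skew symmetry in each pair of slots.\<close>

lemma curvature_pair_sym:
  assumes f: "field X" "field Y" "field Z" "field W"
  shows "g p (R X Y Z p) (W p) = g p (R Z W X p) (Y p)"
proof -
  define r where "r X Y Z W = g p (R X Y Z p) (W p)" for X Y Z W
  have b: "r X Y Z W + r Y Z X W + r Z X Y W = 0" if "field X" "field Y" "field Z" "field W" for X Y Z W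
  proof -
    have "g p (R X Y Z p + R Y Z X p + R Z X Y p) (W p) = 0"
      using bianchi1[OF that(1-3)] by (simp add: metric_simps)
    then show ?thesis by (simp add: r_def metric_simps)
  qed
  have a: "r X Y Z W = - r Y X Z W" if "field X" "field Y" "field Z" "field W" for X Y Z W
    unfolding r_def curvature_antisym[OF that(1-3)] by (simp add: metric_simps)
  have s: "r X Y Z W = - r X Y W Z" if "field X" "field Y" "field Z" "field W" for X Y Z W
    unfolding r_def curvature_skew[OF that] by (simp add: metric_sym[of p "Z p"])
  have "r X Y Z W = r Z W X Y"
    using b[OF f(1,2,3,4)] b[OF f(2,3,4,1)] b[OF f(3,4,1,2)] b[OF f(4,1,2,3)]
      a[OF f(3,1,2,4)] s[OF f(2,3,4,1)] s[OF f(3,4,2,1)] a[OF f(4,2,3,1)] s[OF f(2,4,3,1)]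
      a[OF f(4,1,3,2)] s[OF f(1,4,3,2)] s[OF f(1,3,4,2)] a[OF f(4,1,2,3)] s[OF f(1,2,4,3)]
    by linarith
  then show ?thesis by (simp add: r_def)
qed

subsection \<open>The Ricci tensor\<close>

lemma ricci_eq_trace: "ricci A nabla Y Z p = trace (\<lambda>X. R X Y Z) p"
  by (simp add: ricci_def trace_def)

lemma tensor2_ricci: "tensor2 (ricci A nabla)"
  unfolding tensor2_def
proof (intro conjI allI impI tensorialI)
  fix Y Z assume "field Y" "field Z"
  then have "smoothf (trace (\<lambda>X. R X Y Z))"
    by (intro smooth_fun_trace tensorial_curvature1) auto
  then show "smoothf (ricci A nabla Y Z)"
    by (simp add: ricci_eq_trace[abs_def])
next
  fix Y Y' Z p assume f: "field Y" "field Y'" "field Z"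
  show "ricci A nabla (\<lambda>p. Y p + Y' p) Z p = ricci A nabla Y Z p + ricci A nabla Y' Z p"
    unfolding ricci_eq_trace trace_add[symmetric]
    by (rule trace_cong) (simp add: tensorial_add[OF tensorial_curvature2] f)
  show "ricci A nabla Z (\<lambda>p. Y p + Y' p) p = ricci A nabla Z Y p + ricci A nabla Z Y' p"
    unfolding ricci_eq_trace trace_add[symmetric]
    by (rule trace_cong) (simp add: tensorial_add[OF tensorial_curvature3] f)
next
  fix h Y Z p assume f: "smoothf h" "field Y" "field Z"
  show "ricci A nabla (\<lambda>p. h p *\<^sub>R Y p) Z p = h p *\<^sub>R ricci A nabla Y Z p"
    unfolding ricci_eq_trace real_scaleR_def trace_scaleR[symmetric]
    by (rule trace_cong) (simp add: tensorial_scaleR[OF tensorial_curvature2] f)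
  show "ricci A nabla Z (\<lambda>p. h p *\<^sub>R Y p) p = h p *\<^sub>R ricci A nabla Z Y p"
    unfolding ricci_eq_trace real_scaleR_def trace_scaleR[symmetric]
    by (rule trace_cong) (simp add: tensorial_scaleR[OF tensorial_curvature3] f)
qed

text \<open>Trace \<open>R \<cdot> R = 0\<close> over the argument that is traced in \<open>S\<close>: the two terms in which \<open>R(X,Y)\<close> acts on
  this argument or on the value form a commutator and cancel.\<close>

lemma semisymmetric_imp_ricci_semisymmetric:
  assumes "semisymmetric A nabla"
  shows "ricci_semisymmetric A nabla"
  unfolding ricci_semisymmetric_def
proof (intro allI impI)
  fix X Y X1 X2 p
  assume f: "field X" "field Y" "field X1" "field X2"
  let ?K = "\<lambda>U. R X Y U" and ?L = "\<lambda>U. R U X1 X2"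
  have "R X Y (R U X1 X2) p - R (R X Y U) X1 X2 p - R U (R X Y X1) X2 p - R U X1 (R X Y X2) p = 0"
    if "field U" for U
    using assms f that unfolding semisymmetric_def Let_def by blast
  then have "trace (\<lambda>U p. ?K (?L U) p - ?L (?K U) p - R U (R X Y X1) X2 p - R U X1 (R X Y X2) p) p =
      trace (\<lambda>U p. 0) p"
    by (intro trace_cong)
  then have "trace (\<lambda>U. ?K (?L U)) p - trace (\<lambda>U. ?L (?K U)) p - ricci A nabla (R X Y X1) X2 p -
      ricci A nabla X1 (R X Y X2) p = 0"
    by (simp add: trace_diff trace_zero ricci_eq_trace)
  moreover have "trace (\<lambda>U. ?K (?L U)) p = trace (\<lambda>U. ?L (?K U)) p"
    using f by (intro trace_commute tensorial_curvature3 tensorial_curvature1) auto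
  ultimately show "- ricci A nabla (R X Y X1) X2 p - ricci A nabla X1 (R X Y X2) p = 0"
    by simp
qed

section \<open>Covariant differentiation commutes with the trace\<close>

lemma tensorial_nabla_op:
  assumes X: "field X" and L: "tensorial L" "\<And>Y. field Y \<Longrightarrow> field (L Y)"
  shows "tensorial (\<lambda>Y q. nabla X (L Y) q - L (nabla X Y) q)"
proof (rule tensorialI)
  fix Y Y' p assume "field Y" "field Y'"
  then show "nabla X (L (\<lambda>p. Y p + Y' p)) p - L (nabla X (\<lambda>p. Y p + Y' p)) p =
      nabla X (L Y) p - L (nabla X Y) p + (nabla X (L Y') p - L (nabla X Y') p)"
    using X L(2) by (simp add: tensorial_add[OF L(1)] nabla_add)
next
  fix h Y p assume "smoothf h" "field Y"
  then show "nabla X (L (\<lambda>p. h p *\<^sub>R Y p)) p - L (nabla X (\<lambda>p. h p *\<^sub>R Y p)) p =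
      h p *\<^sub>R (nabla X (L Y) p - L (nabla X Y) p)"
    using X L(2) by (simp add: tensorial_add[OF L(1)] tensorial_scaleR[OF L(1)] nabla_scaleR algebra_simps)
qed

text \<open>Differentiate the frame formula for \<rho> tr L at a point where \<rho> = 1. The
  derivatives of \<rho> cancel, and the derivatives of the frame add up to the correction
  L(\<nabla>E). \<open>M\<close> holds the matrix of L and \<open>N\<close> the connection
  coefficients.\<close>

lemma vf_deriv_trace:
  assumes X: "field X" and L: "tensorial L" "\<And>Y. field Y \<Longrightarrow> field (L Y)"
  shows "der X (trace L) p = trace (\<lambda>Y q. nabla X (L Y) q - L (nabla X Y) q) p"
proof -
  obtain \<rho> E t where f: "cutoff_frame \<rho> E t" and \<rho>1: "\<rho> p = 1" by (rule exists_cutoff_frame)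
  note \<rho> = cutoff_frameD(1)[OF f] \<rho>1 and [simp] = cutoff_frameD(2,4)[OF f]
    and lin = cutoff_frameD(3)[OF f] and frame = cutoff_frameD(5)[OF f] and dual = cutoff_frameD(6)[OF f]
    and tr = trace_cutoff_frame[OF _ _ f]
  define M where "M c b q = t b q (L (E c) q)" for b c q
  define N where "N c b = t b p (nabla X (E c) p)" for b c
  define K where "K Y q = nabla X (L Y) q - L (nabla X Y) q" for Y q
  have M: "smoothf (M c b)" if "c \<in> Basis" "b \<in> Basis" for b c
    unfolding M_def using that L(2) by simp
  have u: "(\<lambda>q. \<rho> q * trace L q) = (\<lambda>q. \<Sum>c\<in>Basis. M c c q)"
    using tr[OF L] by (simp add: M_def)
  have "der X (\<lambda>q. \<rho> q * trace L q) p = (\<Sum>c\<in>Basis. der X (M c c) p)"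
    unfolding u by (rule vf_deriv_sum) (auto simp: M)
  then have 1: "der X \<rho> p * trace L p + der X (trace L) p = (\<Sum>c\<in>Basis. der X (M c c) p)"
    using \<rho> smooth_fun_trace[OF L] by (simp add: vf_deriv_mult)
  \<comment> \<open>Obtained by covariant differentiation of \<rho> L(E c) = \<Sum> M c b E b,
    followed by the dual form \<open>t c\<close>.\<close>
  have 2: "der X \<rho> p * M c c p + t c p (nabla X (L (E c)) p) = der X (M c c) p + (\<Sum>b\<in>Basis. M c b p * N b c)"
    if c: "c \<in> Basis" for c
  proof -
    have "(\<lambda>q. \<rho> q *\<^sub>R L (E c) q) = (\<lambda>q. \<Sum>b\<in>Basis. M c b q *\<^sub>R E b q)"
      by (simp add: M_def frame)
    then have "nabla X (\<lambda>q. \<rho> q *\<^sub>R L (E c) q) p = nabla X (\<lambda>q. \<Sum>b\<in>Basis. M c b q *\<^sub>R E b q) p"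
      by simp
    then have "der X \<rho> p *\<^sub>R L (E c) p + nabla X (L (E c)) p =
        (\<Sum>b\<in>Basis. der X (M c b) p *\<^sub>R E b p + M c b p *\<^sub>R nabla X (E b) p)"
      using c X \<rho> L(2) M by (simp add: nabla_sum nabla_scaleR)
    then have "t c p (der X \<rho> p *\<^sub>R L (E c) p + nabla X (L (E c)) p) =
        t c p (\<Sum>b\<in>Basis. der X (M c b) p *\<^sub>R E b p + M c b p *\<^sub>R nabla X (E b) p)"
      by simp
    then have "der X \<rho> p * M c c p + t c p (nabla X (L (E c)) p) =
        (\<Sum>b\<in>Basis. der X (M c b) p * t c p (E b p) + M c b p * N b c)"
      using c by (simp add: linear_add[OF lin] linear_cmul[OF lin] linear_sum[OF lin] M_def N_def)
    also have "\<dots> = (\<Sum>b\<in>Basis. if c = b then der X (M c b) p else 0) + (\<Sum>b\<in>Basis. M c b p * N b c)"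
      unfolding sum.distrib[symmetric] using c \<rho> by (intro sum.cong) (auto simp: dual)
    also have "(\<Sum>b\<in>Basis. if c = b then der X (M c b) p else 0) = der X (M c c) p"
      using c by simp
    finally show ?thesis .
  qed
  have "der X \<rho> p * trace L p + (\<Sum>c\<in>Basis. t c p (nabla X (L (E c)) p)) =
      (\<Sum>c\<in>Basis. der X \<rho> p * M c c p + t c p (nabla X (L (E c)) p))"
    using fun_cong[OF u, of p] \<rho> by (simp add: sum.distrib sum_distrib_left)
  also have "\<dots> = (\<Sum>c\<in>Basis. der X (M c c) p) + (\<Sum>c\<in>Basis. \<Sum>b\<in>Basis. M c b p * N b c)"
    by (simp add: 2 sum.distrib)
  finally have "der X (trace L) p =
      (\<Sum>c\<in>Basis. t c p (nabla X (L (E c)) p)) - (\<Sum>c\<in>Basis. \<Sum>b\<in>Basis. M c b p * N b c)"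
    using 1 by simp
  also have "(\<Sum>c\<in>Basis. \<Sum>b\<in>Basis. M c b p * N b c) = (\<Sum>b\<in>Basis. \<Sum>c\<in>Basis. M c b p * N b c)"
    by (rule sum.swap)
  also have "\<dots> = (\<Sum>b\<in>Basis. t b p (L (nabla X (E b)) p))"
  proof (rule sum.cong[OF refl])
    fix b :: 'e assume b: "b \<in> Basis"
    \<comment> \<open>For fixed \<open>b\<close> the numbers \<open>N b c\<close> are the frame
      coefficients of the derivative of \<open>E b\<close>, so after the exchange of sums the inner
      sum applies L to that derivative.\<close>
    have "L (nabla X (E b)) p = (\<Sum>c\<in>Basis. N b c *\<^sub>R L (E c) p)"
      using tensorial_cutoff_frame[OF L(1) _ f, of "nabla X (E b)" p] b X \<rho>(2)
      by (simp add: N_def)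
    then show "(\<Sum>c\<in>Basis. M c b p * N b c) = t b p (L (nabla X (E b)) p)"
      using b by (simp add: linear_sum[OF lin] linear_cmul[OF lin] M_def mult.commute)
  qed
  also have "(\<Sum>c\<in>Basis. t c p (nabla X (L (E c)) p)) - (\<Sum>b\<in>Basis. t b p (L (nabla X (E b)) p)) =
      (\<Sum>c\<in>Basis. t c p (K (E c) p))"
    unfolding sum_subtractf[symmetric] K_def by (intro sum.cong) (simp_all add: linear_diff[OF lin])
  also have "\<dots> = trace K p"
  proof -
    have "field (K Y)" if "field Y" for Y
      unfolding K_def using that X L(2) by simp
    then show ?thesis
      using tr[of K p] tensorial_nabla_op[OF X L] \<rho>(2) by (simp add: K_def[abs_def])
  qed
  finally show ?thesis by (simp add: K_def[abs_def])
qed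

end

section \<open>Regular f-Kenmotsu manifolds\<close>

locale regular_f_kenmotsu_manifold = smooth_manifold A
  for A :: "('a::t2_space, 'e::euclidean_space) chart set" +
  fixes \<phi> :: "'a \<Rightarrow> 'e \<Rightarrow> 'e" and \<xi> :: "'a \<Rightarrow> 'e" and \<eta> :: "'a \<Rightarrow> 'e \<Rightarrow> real"
    and g :: "'a \<Rightarrow> 'e \<Rightarrow> 'e \<Rightarrow> real" and nabla :: "('a, 'e) connection"
    and f :: "'a \<Rightarrow> real" and n :: nat
  assumes n: "n \<ge> 1" "DIM('e) = 2 * n + 1"
    and kenmotsu: "regular_f_kenmotsu A \<phi> \<xi> \<eta> g nabla f"
begin

lemma f_kenmotsu: "f_kenmotsu A \<phi> \<xi> \<eta> g nabla f"
  using kenmotsu by (simp add: regular_f_kenmotsu_def)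

lemma almost_contact: "almost_contact_metric A \<phi> \<xi> \<eta> g"
  using f_kenmotsu by (simp add: f_kenmotsu_def)

sublocale riemannian_manifold A g nabla
  using f_kenmotsu almost_contact
  by unfold_locales (simp_all add: f_kenmotsu_def almost_contact_metric_def)

section \<open>Derivative and curvature of the structure field \<xi>\<close>

lemma vector_field_xi [simp]: "field \<xi>"
  using almost_contact by (simp add: almost_contact_metric_def)

lemma smooth_fun_f [simp]: "smoothf f"
  using f_kenmotsu by (simp add: f_kenmotsu_def)

lemma eta_eq: "\<eta> p v = g p v (\<xi> p)"
  using almost_contact by (simp add: almost_contact_metric_def)

lemma eta_xi [simp]: "\<eta> p (\<xi> p) = 1"
  using almost_contact unfolding almost_contact_metric_def by blast

lemma metric_xi: "g p v (\<xi> p) = \<eta> p v" "g p (\<xi> p) v = \<eta> p v"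
  by (simp_all add: eta_eq metric_sym)

lemma smooth_fun_eta [simp]: "field X \<Longrightarrow> smoothf (\<lambda>p. \<eta> p (X p))"
  by (simp add: eta_eq)

lemma linear_eta: "linear (\<eta> p)"
  using almost_contact by (simp add: almost_contact_metric_def one_form_def)

lemmas eta_simps = linear_add[OF linear_eta] linear_diff[OF linear_eta] linear_cmul[OF linear_eta]
  linear_neg[OF linear_eta]

lemma tensorial_eta: "tensorial (\<lambda>X p. \<eta> p (X p))"
  by (rule tensorialI) (simp_all add: eta_simps)

text \<open>Put Y = \<xi> into the structure equation, use \<phi>\<xi> = 0 and apply \<phi> once
  more. This determines the part orthogonal to \<xi>; the \<xi>-component vanishes because g(\<xi>,
  \<xi>) is constant.\<close>

lemma nabla_xi:
  assumes X: "field X"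
  shows "nabla X \<xi> = (\<lambda>p. f p *\<^sub>R (X p - \<eta> p (X p) *\<^sub>R \<xi> p))"
proof
  fix p
  have phi: "\<phi> p (\<phi> p v) = - v + \<eta> p v *\<^sub>R \<xi> p" "\<eta> p (\<phi> p v) = 0" "\<phi> p (\<xi> p) = 0" "linear (\<phi> p)"
    for p v
    using almost_contact unfolding almost_contact_metric_def tensor_field_1_1_def by blast+
  have "nabla X (\<lambda>q. \<phi> q (\<xi> q)) p - \<phi> p (nabla X \<xi> p) =
      f p *\<^sub>R (g p (\<phi> p (X p)) (\<xi> p) *\<^sub>R \<xi> p - \<eta> p (\<xi> p) *\<^sub>R \<phi> p (X p))"
    using f_kenmotsu X vector_field_xi unfolding f_kenmotsu_def by blast
  then have "\<phi> p (nabla X \<xi> p) = f p *\<^sub>R \<phi> p (X p)"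
    using X by (simp add: phi nabla_zero metric_xi)
  then have "\<phi> p (\<phi> p (nabla X \<xi> p)) = \<phi> p (f p *\<^sub>R \<phi> p (X p))"
    by simp
  then have "- nabla X \<xi> p + \<eta> p (nabla X \<xi> p) *\<^sub>R \<xi> p = f p *\<^sub>R (- X p + \<eta> p (X p) *\<^sub>R \<xi> p)"
    by (simp add: linear_cmul[OF phi(4)] phi(1))
  moreover have "\<eta> p (nabla X \<xi> p) = 0"
    using vf_deriv_metric[OF X vector_field_xi vector_field_xi, of p]
    by (simp add: metric_xi vf_deriv_const)
  ultimately have "- nabla X \<xi> p = - (f p *\<^sub>R (X p - \<eta> p (X p) *\<^sub>R \<xi> p))"
    by (simp add: algebra_simps)
  then show "nabla X \<xi> p = f p *\<^sub>R (X p - \<eta> p (X p) *\<^sub>R \<xi> p)"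
    by (simp only: neg_equal_iff_equal)
qed

text \<open>Evaluate the condition that df and \<eta> have zero wedge product on the pair X,
  \<xi>.\<close>

lemma vf_deriv_f: "der X f p = der \<xi> f p * \<eta> p (X p)"
proof -
  have "differential A f p (X p) * \<eta> p (\<xi> p) - differential A f p (\<xi> p) * \<eta> p (X p) = 0"
    using f_kenmotsu unfolding f_kenmotsu_def by blast
  then show ?thesis by (simp add: vf_deriv_def)
qed

lemma vf_deriv_eta:
  assumes "field X" "field Y"
  shows "der X (\<lambda>p. \<eta> p (Y p)) p =
    \<eta> p (nabla X Y p) + f p * (g p (X p) (Y p) - \<eta> p (X p) * \<eta> p (Y p))"
  using vf_deriv_metric[OF assms vector_field_xi, of p] assms
  by (simp add: nabla_xi metric_simps metric_xi metric_sym[of p "Y p" "X p"])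

text \<open>Up to sign the sectional curvature: every tangent plane containing \<xi> has curvature -
  \<kappa>.\<close>

definition \<kappa> :: "'a \<Rightarrow> real" where
  "\<kappa> p = (f p)\<^sup>2 + der \<xi> f p"

lemma smooth_fun_kappa [simp]: "smoothf \<kappa>"
  unfolding \<kappa>_def[abs_def] by simp

lemma kappa_nonzero: "\<kappa> p \<noteq> 0"
  using kenmotsu by (simp add: regular_f_kenmotsu_def \<kappa>_def)

text \<open>Differentiate \<open>nabla_xi\<close> once more and antisymmetrize. In \<kappa> the
  summand f^2 comes from using \<open>nabla_xi\<close> twice, and \<xi>(f) from the derivative of f,
  which is \<xi>(f) \<eta>.\<close>

lemma curvature_xi:
  assumes "field X" "field Y"
  shows "R X Y \<xi> p = - (\<kappa> p *\<^sub>R (\<eta> p (Y p) *\<^sub>R X p - \<eta> p (X p) *\<^sub>R Y p))"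
proof -
  have 1: "nabla U (nabla W \<xi>) p =
      (der \<xi> f p * \<eta> p (U p)) *\<^sub>R (W p - \<eta> p (W p) *\<^sub>R \<xi> p) + f p *\<^sub>R (nabla U W p -
        ((\<eta> p (nabla U W p) + f p * (g p (U p) (W p) - \<eta> p (U p) * \<eta> p (W p))) *\<^sub>R \<xi> p +
         (\<eta> p (W p) * f p) *\<^sub>R (U p - \<eta> p (U p) *\<^sub>R \<xi> p)))"
    if "field U" "field W" for U W
    using that by (simp add: nabla_xi nabla_scaleR nabla_diff vf_deriv_f[of U] vf_deriv_eta)
  show ?thesis
    unfolding curvature_def 1[OF assms] 1[OF assms(2,1)] nabla_xi[OF vector_field_bracket[OF assms]]
    unfolding bracket_eq[OF assms]
    by (simp add: \<kappa>_def metric_sym[of p "Y p" "X p"] eta_simps algebra_simps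
        power2_eq_square)
qed

text \<open>Pair symmetry and skew symmetry give g(R(Y, \<xi>)Z, W) = g(R(Z, W)Y, \<xi>) = - g(Y,
  R(Z, W)\<xi>), where the last curvature is known.\<close>

lemma curvature_xi2:
  assumes "field Y" "field Z"
  shows "R Y \<xi> Z = (\<lambda>p. \<kappa> p *\<^sub>R (g p (Y p) (Z p) *\<^sub>R \<xi> p - \<eta> p (Z p) *\<^sub>R Y p))"
proof (rule ext, rule metric_eqI)
  fix p w
  define W where "W = extend_vector A p w"
  have W: "field W" "W p = w" by (auto simp: W_def extend_vector)
  have "g p (R Y \<xi> Z p) w = g p (R Z W Y p) (\<xi> p)"
    using curvature_pair_sym[OF assms(1) vector_field_xi assms(2) W(1), of p] W(2) by simp
  also have "\<dots> = - g p (Y p) (R Z W \<xi> p)"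
    by (rule curvature_skew[OF assms(2) W(1) assms(1) vector_field_xi])
  also have "\<dots> = g p (\<kappa> p *\<^sub>R (g p (Y p) (Z p) *\<^sub>R \<xi> p - \<eta> p (Z p) *\<^sub>R Y p)) w"
    using assms W by (simp add: curvature_xi metric_simps metric_xi algebra_simps)
  finally show "g p (R Y \<xi> Z p) w = g p (\<kappa> p *\<^sub>R (g p (Y p) (Z p) *\<^sub>R \<xi> p - \<eta> p (Z p) *\<^sub>R Y p)) w" .
qed

subsection \<open>Tensors annihilated by the curvature\<close>

text \<open>Inserting \<open>\<xi>\<close> into \<open>R \<cdot> T = 0\<close> leaves the symmetric part of \<open>T\<close> as claimed and an
  antisymmetric part \<open>\<eta> \<otimes> \<omega> - \<omega> \<otimes> \<eta>\<close>; a trace, which needs \<open>dim M > 2\<close>, then gives \<open>\<omega> = 0\<close>. In this way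
  the symmetry of the Ricci tensor is never needed.\<close>

lemma curvature_annihilates_imp_metric:
  assumes T: "tensor2 T"
    and ann: "\<And>X Y Z W p. field X \<Longrightarrow> field Y \<Longrightarrow> field Z \<Longrightarrow> field W \<Longrightarrow>
      T (R X Y Z) W p + T Z (R X Y W) p = 0"
    and XY: "field X" "field Y"
  shows "T X Y p = T \<xi> \<xi> p * g p (X p) (Y p)"
proof -
  note l = tensorial_scaleR[OF tensor2D(2)[OF T]] tensorial_diff[OF tensor2D(2)[OF T]]
    and r = tensorial_scaleR[OF tensor2D(3)[OF T]] tensorial_diff[OF tensor2D(3)[OF T]]
  have e: "g p (X p) (Z p) * T \<xi> W p - \<eta> p (Z p) * T X W p + g p (X p) (W p) * T Z \<xi> p
      - \<eta> p (W p) * T Z X p = 0"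
    if "field X" "field Z" "field W" for X Z W p
  proof -
    have "\<kappa> p * (g p (X p) (Z p) * T \<xi> W p - \<eta> p (Z p) * T X W p + g p (X p) (W p) * T Z \<xi> p
        - \<eta> p (W p) * T Z X p) = 0"
      using ann[OF that(1) vector_field_xi that(2,3), of p] that
      by (simp add: curvature_xi2 l r algebra_simps)
    then show ?thesis using kappa_nonzero[of p] by simp
  qed
  \<comment> \<open>The case Z = \<xi>: the whole of T is expressed by g, \<eta> and T(\<xi>,
    -).\<close>
  have T1: "T X W p = T \<xi> \<xi> p * g p (X p) (W p) + \<eta> p (X p) * T \<xi> W p - \<eta> p (W p) * T \<xi> X p"
    if "field X" "field W" for X W p
    using e[OF that(1) vector_field_xi that(2), of p] by (simp add: metric_xi algebra_simps)
  \<comment> \<open>The deviation of T(\<xi>, -) from the expected multiple of \<eta>; it vanishes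
    on \<xi>.\<close>
  define \<omega> where "\<omega> Z p = T \<xi> Z p - T \<xi> \<xi> p * \<eta> p (Z p)" for Z p
  have \<omega>: "tensorial \<omega>"
    unfolding \<omega>_def
    by (rule tensorialI) (simp_all add: tensorial_add[OF tensor2D(3)[OF T]] r eta_simps algebra_simps)
  have \<omega>0: "\<omega> W p = 0" if W: "field W" for W p
  proof -
    let ?U = "\<lambda>q. W q - \<eta> q (W q) *\<^sub>R \<xi> q"
    \<comment> \<open>Substituting \<open>T1\<close> back into \<open>e\<close> leaves an identity
      in g, \<eta> and \<omega> only, stated as an operator in Z so that its trace can be
      taken.\<close>
    have L: "\<omega> W q *\<^sub>R (Z q - \<eta> q (Z q) *\<^sub>R \<xi> q) - \<omega> Z q *\<^sub>R ?U q = 0" if Z: "field Z" for Z q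
    proof (rule metric_eqI)
      fix x
      define X where "X = extend_vector A q x"
      have X: "field X" "X q = x" by (auto simp: X_def extend_vector)
      have "(g q x (Z q) - \<eta> q (Z q) * \<eta> q x) * \<omega> W q - (g q x (W q) - \<eta> q (W q) * \<eta> q x) * \<omega> Z q = 0"
        using e[OF X(1) Z W, of q] T1[OF X(1) W, of q] T1[OF Z X(1), of q] T1[OF Z vector_field_xi, of q]
        by (simp add: X(2) \<omega>_def metric_xi metric_sym[of q "Z q" x] algebra_simps)
      then show "g q (\<omega> W q *\<^sub>R (Z q - \<eta> q (Z q) *\<^sub>R \<xi> q) - \<omega> Z q *\<^sub>R ?U q) x = g q 0 x"
        by (simp add: metric_simps metric_xi metric_sym[of q _ x] algebra_simps)
    qed
    have "trace (\<lambda>Z q. \<omega> W q *\<^sub>R (Z q - \<eta> q (Z q) *\<^sub>R \<xi> q) - \<omega> Z q *\<^sub>R ?U q) p = trace (\<lambda>Z q. 0) p"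
      by (rule trace_cong) (rule L)
    moreover have "trace (\<lambda>Z q. \<eta> q (Z q) *\<^sub>R \<xi> q) p = 1"
      using trace_rank_one[OF tensorial_eta vector_field_xi] by simp
    moreover have "trace (\<lambda>Z q. \<omega> Z q *\<^sub>R ?U q) p = \<omega> W p"
    proof -
      have "trace (\<lambda>Z q. \<omega> Z q *\<^sub>R ?U q) p = \<omega> ?U p"
        by (rule trace_rank_one[OF \<omega>]) (simp add: W)
      also have "\<dots> = \<omega> W p - \<eta> p (W p) * \<omega> \<xi> p"
        using W by (simp add: tensorial_diff[OF \<omega>] tensorial_scaleR[OF \<omega>])
      also have "\<omega> \<xi> p = 0" by (simp add: \<omega>_def)
      finally show ?thesis by simp
    qed
    \<comment> \<open>Projection off \<xi> has trace 2 n and the rank one term has trace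
      \<omega>(W). The factor 2 n - 1 is an odd integer, hence not zero.\<close>
    ultimately have "\<omega> W p * (real (2 * n + 1) - 1) - \<omega> W p = 0"
      unfolding trace_diff trace_scaleR trace_id trace_zero n(2) by simp
    then have "\<omega> W p * (2 * real n - 1) = 0" by (simp add: algebra_simps)
    then show ?thesis using n(1) by simp
  qed
  have "T \<xi> X p = T \<xi> \<xi> p * \<eta> p (X p)" "T \<xi> Y p = T \<xi> \<xi> p * \<eta> p (Y p)"
    using \<omega>0[OF XY(1), of p] \<omega>0[OF XY(2), of p] unfolding \<omega>_def by linarith+
  then show ?thesis unfolding T1[OF XY] by simp
qed

lemma constant_if_vf_deriv_zero:
  assumes "connected (UNIV :: 'a set)" "smoothf h" "\<And>X p. field X \<Longrightarrow> der X h p = 0"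
  shows "h p = h q"
proof (rule constant_if_differential_zero[OF assms(1,2)])
  show "differential A h p v = 0" for p v
    using assms(3)[OF extend_vector(1)[of p v], of p] by (simp add: vf_deriv_def extend_vector)
qed

lemma parallel_imp_constant_multiple_of_metric:
  assumes conn: "connected (UNIV :: 'a set)" and T: "tensor2 T" "parallel A nabla T"
  obtains a where "\<And>X Y p. field X \<Longrightarrow> field Y \<Longrightarrow> T X Y p = a * g p (X p) (Y p)"
proof -
  have ann: "T (R X Y Z) W p + T Z (R X Y W) p = 0"
    if "field X" "field Y" "field Z" "field W" for X Y Z W p
    by (rule parallel_imp_curvature_annihilates[where T = T, OF T that])
  have eq: "T X Y p = T \<xi> \<xi> p * g p (X p) (Y p)" if "field X" "field Y" for X Y p
    by (rule curvature_annihilates_imp_metric[where T = T, OF T(1) ann that])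
  have "der X (T \<xi> \<xi>) p = 0" if "field X" for X p
  proof -
    have "der X (T \<xi> \<xi>) p - T (nabla X \<xi>) \<xi> p - T \<xi> (nabla X \<xi>) p = 0"
      using T(2)[unfolded parallel_def, rule_format, OF that vector_field_xi vector_field_xi] .
    moreover have "\<eta> p (nabla X \<xi> p) = 0"
      using that by (simp add: nabla_xi eta_simps)
    then have "T (nabla X \<xi>) \<xi> p = 0" "T \<xi> (nabla X \<xi>) p = 0"
      unfolding eq[OF vector_field_nabla[OF that vector_field_xi] vector_field_xi]
        eq[OF vector_field_xi vector_field_nabla[OF that vector_field_xi]] by (simp_all add: metric_xi)
    ultimately show ?thesis by simp
  qed
  then have const: "T \<xi> \<xi> p = T \<xi> \<xi> q" for p q
    by (rule constant_if_vf_deriv_zero[OF conn tensor2D(1)[OF T(1) vector_field_xi vector_field_xi]])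
  show ?thesis
  proof (rule that)
    \<comment> \<open>\<open>undefined\<close> serves as an arbitrary base point; by
      \<open>const\<close> any point gives the same factor.\<close>
    show "T X Y p = T \<xi> \<xi> undefined * g p (X p) (Y p)" if "field X" "field Y" for X Y p
      unfolding eq[OF that] const[of p undefined] ..
  qed
qed

subsection \<open>Einstein metrics\<close>

text \<open>The trace of \<eta> \<otimes> \<xi> - I is 1 - (2 n + 1).\<close>

lemma ricci_xi_xi: "ricci A nabla \<xi> \<xi> p = - 2 * n * \<kappa> p"
proof -
  have "ricci A nabla \<xi> \<xi> p = trace (\<lambda>X p. \<kappa> p *\<^sub>R (\<eta> p (X p) *\<^sub>R \<xi> p - X p)) p"
    unfolding ricci_eq_trace by (rule trace_cong) (simp add: curvature_xi2 metric_xi)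
  also have "\<dots> = \<kappa> p * (1 - real (2 * n + 1))"
    unfolding trace_scaleR trace_diff trace_id n(2)
      trace_rank_one[OF tensorial_eta vector_field_xi] by simp
  finally show ?thesis by (simp add: algebra_simps)
qed

text \<open>\<open>vf_deriv_trace\<close> for the operator R(-, Y)Z absorbs the first correction
  term. The other two trace to the correction terms of the covariant derivative of S.\<close>

lemma trace_nabla_curvature:
  assumes "field U" "field Y" "field Z"
  shows "trace (\<lambda>X. nabla_curvature U X Y Z) p =
    der U (ricci A nabla Y Z) p - ricci A nabla (nabla U Y) Z p - ricci A nabla Y (nabla U Z) p"
proof -
  have "trace (\<lambda>X. nabla_curvature U X Y Z) p = trace (\<lambda>X q. (nabla U (R X Y Z) q - R (nabla U X) Y Z q)
      - R X (nabla U Y) Z q - R X Y (nabla U Z) q) p"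
    by (simp add: nabla_curvature_def[abs_def])
  also have "\<dots> = der U (trace (\<lambda>X. R X Y Z)) p - ricci A nabla (nabla U Y) Z p - ricci A nabla Y (nabla U Z) p"
    unfolding trace_diff[of "\<lambda>X q. nabla U (R X Y Z) q - R (nabla U X) Y Z q - R X (nabla U Y) Z q"]
      trace_diff[of "\<lambda>X q. nabla U (R X Y Z) q - R (nabla U X) Y Z q"]
    using vf_deriv_trace[OF assms(1) tensorial_curvature1[OF assms(2,3)], of p] assms
    by (simp add: ricci_eq_trace)
  finally show ?thesis by (simp add: ricci_eq_trace[abs_def])
qed

text \<open>Every term is explicit except the one with \<nabla>\<xi> inserted for \<xi>, which gives
  back the full curvature times f. The summands are arranged so that each has a known trace over
  X.\<close>

lemma nabla_curvature_xi:
  assumes "field X" "field Y" "field Z"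
  shows "nabla_curvature X Y \<xi> Z p =
    der X \<kappa> p *\<^sub>R (g p (Y p) (Z p) *\<^sub>R \<xi> p - \<eta> p (Z p) *\<^sub>R Y p)
    + (\<kappa> p * f p * g p (Y p) (Z p)) *\<^sub>R (X p - \<eta> p (X p) *\<^sub>R \<xi> p)
    - (\<kappa> p * f p) *\<^sub>R (g p (X p) (Z p) *\<^sub>R Y p)
    + (\<kappa> p * f p * \<eta> p (Z p)) *\<^sub>R (\<eta> p (X p) *\<^sub>R Y p)
    + f p *\<^sub>R R X Y Z p + f p *\<^sub>R (\<eta> p (X p) *\<^sub>R R Y \<xi> Z p)"
proof -
  have 1: "nabla X (R Y \<xi> Z) p = der X \<kappa> p *\<^sub>R (g p (Y p) (Z p) *\<^sub>R \<xi> p - \<eta> p (Z p) *\<^sub>R Y p) +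
      \<kappa> p *\<^sub>R ((g p (nabla X Y p) (Z p) + g p (Y p) (nabla X Z p)) *\<^sub>R \<xi> p +
        g p (Y p) (Z p) *\<^sub>R f p *\<^sub>R (X p - \<eta> p (X p) *\<^sub>R \<xi> p) -
        ((\<eta> p (nabla X Z p) + f p * (g p (X p) (Z p) - \<eta> p (X p) * \<eta> p (Z p))) *\<^sub>R Y p +
         \<eta> p (Z p) *\<^sub>R nabla X Y p))"
    using assms by (simp add: curvature_xi2 nabla_scaleR nabla_diff vf_deriv_metric vf_deriv_eta nabla_xi[of X])
  have 2: "R Y (nabla X \<xi>) Z p = f p *\<^sub>R (- R X Y Z p - \<eta> p (X p) *\<^sub>R R Y \<xi> Z p)"
    using assms curvature_antisym[OF assms(2,1,3), of p]
    by (simp add: nabla_xi tensorial_scaleR[OF tensorial_curvature2[OF assms(2,3)]]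
        tensorial_diff[OF tensorial_curvature2[OF assms(2,3)]])
  have 3: "R (nabla X Y) \<xi> Z p = \<kappa> p *\<^sub>R (g p (nabla X Y p) (Z p) *\<^sub>R \<xi> p - \<eta> p (Z p) *\<^sub>R nabla X Y p)"
    "R Y \<xi> (nabla X Z) p = \<kappa> p *\<^sub>R (g p (Y p) (nabla X Z p) *\<^sub>R \<xi> p - \<eta> p (nabla X Z p) *\<^sub>R Y p)"
    using assms by (simp_all add: curvature_xi2)
  show ?thesis
    unfolding nabla_curvature_def 1 2 3 by (simp add: algebra_simps)
qed

text \<open>A variant of Schur's lemma: the trace over \<open>X\<close> of the second Bianchi identity for
  \<open>(X, Y, \<xi>)\<close> suffices, because \<open>\<nabla>\<^sub>X R\<close> is explicit when \<open>\<xi>\<close> is inserted.\<close>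

lemma einstein_imp_vf_deriv_kappa_zero:
  assumes einstein: "\<And>X Y p. field X \<Longrightarrow> field Y \<Longrightarrow>
      ricci A nabla X Y p = ricci A nabla \<xi> \<xi> p * g p (X p) (Y p)"
    and "field Y"
  shows "der Y \<kappa> p = 0"
proof -
  have S: "ricci A nabla X Y = (\<lambda>p. (- 2 * n) * (\<kappa> p * g p (X p) (Y p)))" if "field X" "field Y" for X Y
    using einstein[OF that] by (auto simp: ricci_xi_xi)
  \<comment> \<open>Since g is parallel, only the factor - 2 n \<kappa> of S is
    differentiated.\<close>
  have tr: "trace (\<lambda>X. nabla_curvature U X Y Z) p = - 2 * n * der U \<kappa> p * g p (Y p) (Z p)"
    if "field U" "field Y" "field Z" for U Y Z p
  proof -
    have "der U (ricci A nabla Y Z) p = (- 2 * n) * (der U \<kappa> p * g p (Y p) (Z p) +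
        \<kappa> p * (g p (nabla U Y p) (Z p) + g p (Y p) (nabla U Z p)))"
      unfolding S[OF that(2,3)] using that by (subst vf_deriv_cmult) (simp_all add: vf_deriv_mult vf_deriv_metric)
    then show ?thesis
      unfolding trace_nabla_curvature[OF that] using that by (simp add: S algebra_simps)
  qed
  have main: "der \<xi> \<kappa> p * g p (Y p) (Z p) = der Y \<kappa> p * \<eta> p (Z p)" if f: "field Y" "field Z" for Y Z p
  proof -
    let ?U = "\<lambda>q. g q (Y q) (Z q) *\<^sub>R \<xi> q - \<eta> q (Z q) *\<^sub>R Y q"
    have "trace (\<lambda>X p. nabla_curvature X Y \<xi> Z p - nabla_curvature Y X \<xi> Z p + nabla_curvature \<xi> X Y Z p) p
        = trace (\<lambda>X p. 0) p"
    proof (rule trace_cong)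
      fix X assume X: "field X"
      \<comment> \<open>One Bianchi term has X in the second curvature slot; antisymmetry moves it
        to the slot being traced, at the cost of a sign.\<close>
      have "R \<xi> X Z' = (\<lambda>p. - R X \<xi> Z' p)" if "field X" "field Z'" for X Z'
        using curvature_antisym[OF vector_field_xi that] by auto
      moreover have "R (nabla Y \<xi>) X Z = (\<lambda>p. - R X (nabla Y \<xi>) Z p)"
        using curvature_antisym[OF _ X f(2), of "nabla Y \<xi>"] f by auto
      ultimately have "nabla_curvature Y \<xi> X Z p = - nabla_curvature Y X \<xi> Z p"
        using X f by (simp add: nabla_curvature_def nabla_minus)
      then show "nabla_curvature X Y \<xi> Z p - nabla_curvature Y X \<xi> Z p + nabla_curvature \<xi> X Y Z p = 0"
        using bianchi2[OF X f(1) vector_field_xi f(2), of p] by simp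
    qed
    then have sum0: "trace (\<lambda>X. nabla_curvature X Y \<xi> Z) p + 2 * n * der Y \<kappa> p * \<eta> p (Z p)
        - 2 * n * der \<xi> \<kappa> p * g p (Y p) (Z p) = 0"
      using f by (simp add: trace_add trace_diff trace_zero tr metric_xi)
    have t\<kappa>: "tensorial (\<lambda>X. der X \<kappa>)"
      by (rule tensorialI) (simp_all add: vf_deriv_field_add vf_deriv_field_scaleR)
    have tZ: "tensorial (\<lambda>X q. g q (X q) (Z q))"
      by (rule tensorialI) (simp_all add: metric_simps)
    have U: "field ?U" using f by simp
    have "trace (\<lambda>X. nabla_curvature X Y \<xi> Z) p = trace (\<lambda>X p.
        der X \<kappa> p *\<^sub>R ?U p
        + (\<kappa> p * f p * g p (Y p) (Z p)) *\<^sub>R (X p - \<eta> p (X p) *\<^sub>R \<xi> p)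
        - (\<kappa> p * f p) *\<^sub>R (g p (X p) (Z p) *\<^sub>R Y p)
        + (\<kappa> p * f p * \<eta> p (Z p)) *\<^sub>R (\<eta> p (X p) *\<^sub>R Y p)
        + f p *\<^sub>R R X Y Z p + f p *\<^sub>R (\<eta> p (X p) *\<^sub>R R Y \<xi> Z p)) p"
      by (rule trace_cong) (rule nabla_curvature_xi[OF _ f])
    also have "\<dots> = der ?U \<kappa> p + \<kappa> p * f p * g p (Y p) (Z p) * (real (2 * n + 1) - 1)
        - \<kappa> p * f p * g p (Y p) (Z p) + \<kappa> p * f p * \<eta> p (Z p) * \<eta> p (Y p)
        + f p * ricci A nabla Y Z p + f p * \<eta> p (R Y \<xi> Z p)"
    proof -
      have "trace (\<lambda>X q. \<eta> q (X q) *\<^sub>R W q) p = \<eta> p (W p)" if "field W" for W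
        by (rule trace_rank_one[OF tensorial_eta that])
      then show ?thesis
        using f by (simp only: trace_add trace_diff trace_scaleR trace_id n(2) trace_rank_one[OF t\<kappa> U]
            trace_rank_one[OF tZ f(1)] vector_field_xi vector_field_curvature eta_xi ricci_eq_trace)
    qed
    also have "der ?U \<kappa> p = g p (Y p) (Z p) * der \<xi> \<kappa> p - \<eta> p (Z p) * der Y \<kappa> p"
      by (simp add: vf_deriv_field_diff vf_deriv_field_scaleR)
    also have "\<eta> p (R Y \<xi> Z p) = \<kappa> p * (g p (Y p) (Z p) - \<eta> p (Z p) * \<eta> p (Y p))"
      using f by (simp add: curvature_xi2 eta_simps)
    \<comment> \<open>By S = - 2 n \<kappa> g all terms containing f cancel. Derivatives of \<kappa>
      remain, with coefficient 1 from the explicit trace and - 2 n from the two Ricci terms.\<close>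
    finally have "(1 - 2 * real n) * (der \<xi> \<kappa> p * g p (Y p) (Z p) - der Y \<kappa> p * \<eta> p (Z p)) = 0"
      using sum0 f by (simp add: S algebra_simps)
    then show ?thesis using n(1) by simp
  qed
  \<comment> \<open>\<open>main\<close> says \<xi>(\<kappa>) X = X(\<kappa>) \<xi> for all X. The
    left side has trace (2 n + 1) \<xi>(\<kappa>), the right side only \<xi>(\<kappa>).\<close>
  have "der \<xi> \<kappa> p = 0" for p
  proof -
    have "der \<xi> \<kappa> q *\<^sub>R X q = der X \<kappa> q *\<^sub>R \<xi> q" if X: "field X" for X q
    proof (rule metric_eqI)
      fix z
      show "g q (der \<xi> \<kappa> q *\<^sub>R X q) z = g q (der X \<kappa> q *\<^sub>R \<xi> q) z"
        using main[OF X extend_vector(1)[of q z], of q] by (simp add: extend_vector metric_simps metric_xi)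
    qed
    then have "trace (\<lambda>X q. der \<xi> \<kappa> q *\<^sub>R X q) p = trace (\<lambda>X q. der X \<kappa> q *\<^sub>R \<xi> q) p"
      by (intro trace_cong)
    moreover have "tensorial (\<lambda>X. der X \<kappa>)"
      by (rule tensorialI) (simp_all add: vf_deriv_field_add vf_deriv_field_scaleR)
    ultimately have "der \<xi> \<kappa> p * real (2 * n + 1) = der \<xi> \<kappa> p"
      by (simp only: trace_scaleR trace_id n(2) trace_rank_one[OF _ vector_field_xi])
    then show ?thesis using n(1) by (simp add: algebra_simps)
  qed
  then show ?thesis using main[OF \<open>field Y\<close> vector_field_xi, of p] by simp
qed

lemma ricci_semisymmetric_imp_einstein:
  assumes "connected (UNIV :: 'a set)" "ricci_semisymmetric A nabla"
  obtains s where "\<And>X Y p. field X \<Longrightarrow> field Y \<Longrightarrow> ricci A nabla X Y p = s * g p (X p) (Y p)"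
proof -
  have ann: "ricci A nabla (R X Y Z) W p + ricci A nabla Z (R X Y W) p = 0"
    if "field X" "field Y" "field Z" "field W" for X Y Z W p
  proof -
    have "- ricci A nabla (R X Y Z) W p - ricci A nabla Z (R X Y W) p = 0"
      using assms(2) that unfolding ricci_semisymmetric_def by blast
    then show ?thesis by simp
  qed
  have S: "ricci A nabla X Y p = ricci A nabla \<xi> \<xi> p * g p (X p) (Y p)" if "field X" "field Y" for X Y p
    by (rule curvature_annihilates_imp_metric[where T = "ricci A nabla", OF tensor2_ricci ann that])
  have "\<kappa> p = \<kappa> q" for p q
    by (rule constant_if_vf_deriv_zero[OF assms(1) smooth_fun_kappa])
      (rule einstein_imp_vf_deriv_kappa_zero[OF S])
  then have const: "ricci A nabla \<xi> \<xi> p = ricci A nabla \<xi> \<xi> undefined" for p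
    unfolding ricci_xi_xi by simp
  show ?thesis
  proof (rule that)
    show "ricci A nabla X Y p = ricci A nabla \<xi> \<xi> undefined * g p (X p) (Y p)"
      if "field X" "field Y" for X Y p
      unfolding S[OF that] const[of p] ..
  qed
qed

end

theorem corollary2:
  fixes A :: "('a::{t2_space, second_countable_topology}, 'e::euclidean_space) chart set"
    and \<phi> :: "'a \<Rightarrow> 'e \<Rightarrow> 'e" and \<xi> :: "'a \<Rightarrow> 'e" and \<eta> :: "'a \<Rightarrow> 'e \<Rightarrow> real"
    and g :: "'a \<Rightarrow> 'e \<Rightarrow> 'e \<Rightarrow> real" and nabla :: "('a, 'e) connection"
    and f :: "'a \<Rightarrow> real" and V :: "'a \<Rightarrow> 'e" and n :: nat
  assumes "smooth_atlas A" and "connected (UNIV :: 'a set)"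
    and "n \<ge> 1" and "DIM('e) = 2 * n + 1"
    and "regular_f_kenmotsu A \<phi> \<xi> \<eta> g nabla f"
    and "vector_field A V"
  shows "(parallel A nabla
            (\<lambda>X Y p. lie_derivative A V (as_tensor02 g) X Y p + 2 * ricci A nabla X Y p) \<longrightarrow>
          (\<exists>l. ricci_soliton A nabla g V l)) \<and>
         ((ricci_semisymmetric A nabla \<or> semisymmetric A nabla) \<and>
          parallel A nabla (lie_derivative A V (as_tensor02 g)) \<longrightarrow>
          (\<exists>l. ricci_soliton A nabla g V l))"
proof -
  interpret regular_f_kenmotsu_manifold A \<phi> \<xi> \<eta> g nabla f n
    using assms by unfold_locales
  have lie: "tensor2 (lie_derivative A V (as_tensor02 g))"
    by (rule tensor2_lie_derivative[OF assms(6)])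
  show ?thesis
  proof (intro conjI impI)
    assume "parallel A nabla
      (\<lambda>X Y p. lie_derivative A V (as_tensor02 g) X Y p + 2 * ricci A nabla X Y p)"
    then obtain a where "\<And>X Y p. field X \<Longrightarrow> field Y \<Longrightarrow>
        lie_derivative A V (as_tensor02 g) X Y p + 2 * ricci A nabla X Y p = a * g p (X p) (Y p)"
      using parallel_imp_constant_multiple_of_metric[OF assms(2) tensor2_add_scaled[OF lie tensor2_ricci]]
      by blast
    \<comment> \<open>The constant solves a + 2 l = 0.\<close>
    then have "ricci_soliton A nabla g V (- a / 2)"
      by (simp add: ricci_soliton_def as_tensor02_def)
    then show "\<exists>l. ricci_soliton A nabla g V l" ..
  next
    assume *: "(ricci_semisymmetric A nabla \<or> semisymmetric A nabla) \<and>
      parallel A nabla (lie_derivative A V (as_tensor02 g))"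
    then obtain a where a: "\<And>X Y p. field X \<Longrightarrow> field Y \<Longrightarrow>
        lie_derivative A V (as_tensor02 g) X Y p = a * g p (X p) (Y p)"
      using parallel_imp_constant_multiple_of_metric[OF assms(2) lie] by blast
    from * have "ricci_semisymmetric A nabla"
      using semisymmetric_imp_ricci_semisymmetric by blast
    then obtain s where "\<And>X Y p. field X \<Longrightarrow> field Y \<Longrightarrow> ricci A nabla X Y p = s * g p (X p) (Y p)"
      using ricci_semisymmetric_imp_einstein[OF assms(2)] by blast
    \<comment> \<open>The constant solves a + 2 s + 2 l = 0, with s the Einstein constant.\<close>
    with a have "ricci_soliton A nabla g V (- a / 2 - s)"
      by (simp add: ricci_soliton_def as_tensor02_def algebra_simps)
    then show "\<exists>l. ricci_soliton A nabla g V l" ..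
  qed
qed

end
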